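(* Let $X_0$ be a smooth, embedded, closed curve in the plane. If Gage's area-preserving flow with initial curve $X_0$ does not blow up on the time interval $[0,+\infty)$ (i.e. the evolving curve is smooth for all $t\ge0$), then the evolving curve converges to a circle of finite radius as $t\to\infty$.
   Context: Gage's area-preserving flow: $\frac{\partial X}{\partial t}=\left(\kappa-\frac{2\pi}{L}\right)N$, $X(\cdot,0)=X_0$, where $\kappa$ is the curvature, $N$ the inward unit normal, $L=L(t)$ the length of $X(\cdot,t)$. *)

theory Defs
  imports "HOL-Analysis.Analysis"
begin

text \<open>Plane curves are maps real => complex, parametrised over the real line and
  1-periodic (closed curves).  A time-dependent curve is X :: real => real => complex,
  X t u = position at time t and parameter u.\<close>

coinductive smooth_curve :: "(real \<Rightarrow> complex) \<Rightarrow> bool" where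
  "continuous_on UNIV f \<Longrightarrow> (\<forall>u. (f has_vector_derivative g u) (at u)) \<Longrightarrow>
   smooth_curve g \<Longrightarrow> smooth_curve f"

coinductive smooth_flow :: "(real \<Rightarrow> real \<Rightarrow> complex) \<Rightarrow> bool" where
  "continuous_on ({0..} \<times> UNIV) (\<lambda>(t,u). f t u) \<Longrightarrow>
   (\<forall>t\<ge>0. \<forall>u. ((\<lambda>s. f s u) has_vector_derivative g t u) (at t within {0..})) \<Longrightarrow>
   (\<forall>t\<ge>0. \<forall>u. ((\<lambda>v. f t v) has_vector_derivative h t u) (at u)) \<Longrightarrow>
   smooth_flow g \<Longrightarrow> smooth_flow h \<Longrightarrow> smooth_flow f"

definition closed_curve :: "(real \<Rightarrow> complex) \<Rightarrow> bool" where
  "closed_curve \<gamma> \<longleftrightarrow> (\<forall>u. \<gamma> (u + 1) = \<gamma> u)"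

definition regular_curve :: "(real \<Rightarrow> complex) \<Rightarrow> bool" where
  "regular_curve \<gamma> \<longleftrightarrow> (\<forall>u. \<gamma> differentiable (at u) \<and> vector_derivative \<gamma> (at u) \<noteq> 0)"

definition embedded_closed_curve :: "(real \<Rightarrow> complex) \<Rightarrow> bool" where
  "embedded_closed_curve \<gamma> \<longleftrightarrow> closed_curve \<gamma> \<and> regular_curve \<gamma> \<and> inj_on \<gamma> {0..<1}"

definition unit_tangent :: "(real \<Rightarrow> complex) \<Rightarrow> real \<Rightarrow> complex" where
  "unit_tangent \<gamma> u = (1 / norm (vector_derivative \<gamma> (at u))) *\<^sub>R vector_derivative \<gamma> (at u)"

text \<open>Curvature vector dT/ds = (dT/du) / |X_u|.\<close>
definition curvature_vector :: "(real \<Rightarrow> complex) \<Rightarrow> real \<Rightarrow> complex" where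
  "curvature_vector \<gamma> u =
     (1 / norm (vector_derivative \<gamma> (at u))) *\<^sub>R vector_derivative (unit_tangent \<gamma>) (at u)"

text \<open>Orientation sign of a closed embedded curve: +1 if the left normal i*T points into
  the region enclosed by the curve (counterclockwise curve), -1 otherwise.\<close>
definition orientation_sign :: "(real \<Rightarrow> complex) \<Rightarrow> real" where
  "orientation_sign \<gamma> =
     (if \<exists>\<delta>>0. \<forall>\<epsilon>. 0 < \<epsilon> \<and> \<epsilon> < \<delta> \<longrightarrow>
            \<gamma> 0 + of_real \<epsilon> * (\<i> * unit_tangent \<gamma> 0) \<in> inside (\<gamma> ` {0..1})
      then 1 else -1)"

text \<open>Unit normal N = sigma * i * T; with sigma the orientation sign of the initial curve
  this is the inward unit normal (carried along continuously by the flow).\<close>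
definition unit_normal :: "real \<Rightarrow> (real \<Rightarrow> complex) \<Rightarrow> real \<Rightarrow> complex" where
  "unit_normal \<sigma> \<gamma> u = of_real \<sigma> * (\<i> * unit_tangent \<gamma> u)"

definition curvature :: "real \<Rightarrow> (real \<Rightarrow> complex) \<Rightarrow> real \<Rightarrow> real" where
  "curvature \<sigma> \<gamma> u = curvature_vector \<gamma> u \<bullet> unit_normal \<sigma> \<gamma> u"

definition curve_length :: "(real \<Rightarrow> complex) \<Rightarrow> real" where
  "curve_length \<gamma> = integral {0..1} (\<lambda>u. norm (vector_derivative \<gamma> (at u)))"

definition gage_flow_global :: "(real \<Rightarrow> complex) \<Rightarrow> (real \<Rightarrow> real \<Rightarrow> complex) \<Rightarrow> bool" where
  "gage_flow_global X0 X \<longleftrightarrow>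
     (\<forall>u. X 0 u = X0 u) \<and>
     smooth_flow X \<and>
     (\<forall>t\<ge>0. closed_curve (X t) \<and> regular_curve (X t)) \<and>
     (\<forall>t\<ge>0. \<forall>u. ((\<lambda>s. X s u) has_vector_derivative
         ((curvature (orientation_sign X0) (X t) u - 2 * pi / curve_length (X t))
            *\<^sub>R unit_normal (orientation_sign X0) (X t) u)) (at t within {0..}))"

text \<open>Convergence of the curves X t (as point sets) to the circle of centre c and radius r
  in the Hausdorff sense.\<close>
definition converges_to_circle :: "(real \<Rightarrow> real \<Rightarrow> complex) \<Rightarrow> complex \<Rightarrow> real \<Rightarrow> bool" where
  "converges_to_circle X c r \<longleftrightarrow>
     (\<forall>\<epsilon>>0. \<forall>\<^sub>F t in at_top.
        (\<forall>u. \<bar>norm (X t u - c) - r\<bar> < \<epsilon>) \<and>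
        (\<forall>z. norm (z - c) = r \<longrightarrow> (\<exists>u. norm (X t u - z) < \<epsilon>)))"

end

theory Submission
  imports Defs
begin

text \<open>
  Global existence alone forces the turning number to be one, so no Umlaufsatz is needed. If the
  total curvature is \<open>2 \<pi> m\<close>, then \<open>(L\<^sup>2)' \<le> - 8 \<pi>\<^sup>2 m (m - 1)\<close> and
  \<open>A' = 2 \<pi> (1 - m)\<close>: for \<open>m\<close> other than 0 and 1 the squared length becomes negative in finite
  time, and for \<open>m = 0\<close> the growing area violates the isoperimetric inequality.

  For \<open>m = 1\<close> the area is constant and \<open>L' = - E\<close>, where \<open>E\<close> is the integral of the squared normal
  speed. Hurwitz's proof of the isoperimetric inequality by Wirtinger's inequality shows that the
  deficit \<open>D = L\<^sup>2 - 4 \<pi> A\<close> controls the distance to a circle around the centroid, and, paired with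
  the normal speed, that \<open>2 \<pi>\<^sup>2 D \<le> L\<^sup>3 E\<close>. Hence \<open>A \<le> 0\<close> is again impossible, \<open>D\<close> decays
  exponentially, and so does the drift of the centroid in an integrated sense.
\<close>

text \<open>The flow may create self-intersections, so every estimate is made for immersed loops
  with signed area, and positivity of that area is an outcome of the argument. Curvature enters only
  through integrals over the loop. The delicate point is a limit centre that is fixed. A small
  deficit gives closeness to a circle about the moving centroid, whose speed is bounded only in
  terms of \<open>L * E\<close> and its square root. Integrability of \<open>L * E\<close> in time,
  which boundedness of the length already provides, does not make the square root integrable. The
  inequality between \<open>D\<close> and \<open>E\<close> repairs this because it is linear in
  \<open>D\<close>: it makes \<open>L * E\<close> integrable even against a growing exponential
  weight, and the weight then pays for the square root. Linearity arises because the function paired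
  with the normal speed has itself a squared norm of the order of \<open>D\<close>.\<close>

section \<open>Weighted Cauchy-Schwarz and Wirtinger inequalities\<close>

lemma integral_weighted_Cauchy_Schwarz:
  fixes f g v :: "real \<Rightarrow> real"
  assumes "continuous_on {a..b} f" "continuous_on {a..b} g" "continuous_on {a..b} v"
    and v: "\<And>u. u \<in> {a..b} \<Longrightarrow> 0 \<le> v u"
  shows "(integral {a..b} (\<lambda>u. f u * g u * v u))\<^sup>2
    \<le> integral {a..b} (\<lambda>u. (f u)\<^sup>2 * v u) * integral {a..b} (\<lambda>u. (g u)\<^sup>2 * v u)"
proof -
  note ints = integrable_continuous_real continuous_intros assms(1-3)
  define A where "A = integral {a..b} (\<lambda>u. (f u)\<^sup>2 * v u)"
  define B where "B = integral {a..b} (\<lambda>u. f u * g u * v u)"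
  define C where "C = integral {a..b} (\<lambda>u. (g u)\<^sup>2 * v u)"
  have q: "0 \<le> A - 2 * l * B + l\<^sup>2 * C" for l
  proof -
    have "A - 2 * l * B + l\<^sup>2 * C = integral {a..b} (\<lambda>u. (f u)\<^sup>2 * v u - 2 * l * (f u * g u * v u)
        + l\<^sup>2 * ((g u)\<^sup>2 * v u))"
      unfolding A_def B_def C_def
      by (subst integral_add integral_diff; (intro ints)?)+ simp
    also have "\<dots> = integral {a..b} (\<lambda>u. (f u - l * g u)\<^sup>2 * v u)"
      by (intro integral_cong) (auto simp: power2_eq_square algebra_simps)
    also have "\<dots> \<ge> 0"
      by (intro integral_nonneg ints) (auto simp: v)
    finally show ?thesis .
  qed
  have C0: "0 \<le> C" unfolding C_def by (intro integral_nonneg ints) (auto simp: v)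
  have "B\<^sup>2 \<le> A * C"
  proof (cases "C = 0")
    case True
    have "B = 0"
    proof (rule ccontr)
      assume "B \<noteq> 0"
      \<comment> \<open>For \<open>C = 0\<close> the nonnegative polynomial in \<open>l\<close> is
        affine; at this \<open>l\<close> it would equal -1.\<close>
      with q[of "(A + 1) / (2 * B)"] True show False by simp
    qed
    with True show ?thesis by simp
  next
    case False
    with C0 have "C > 0" by simp
    have "A - 2 * (B / C) * B + (B / C)\<^sup>2 * C = A - B\<^sup>2 / C"
      using \<open>C > 0\<close> by (simp add: power2_eq_square field_simps)
    then have "0 \<le> A - B\<^sup>2 / C" using q[of "B / C"] by simp
    then show ?thesis using \<open>C > 0\<close> by (simp add: pos_divide_le_eq)
  qed
  then show ?thesis unfolding A_def B_def C_def .
qed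

text \<open>The weight \<open>q = w tan (w (s - m))\<close> solves the Riccati equation \<open>q' = v (w\<^sup>2 + q\<^sup>2)\<close>, so
  integrating the square \<open>(y' + q v y)\<^sup>2 / v\<close> leaves only boundary terms. Taking \<open>w\<close> below the
  critical value avoids the poles of the tangent.\<close>

lemma weighted_Wirtinger_interval:
  fixes y y' s v :: "real \<Rightarrow> real"
  assumes ab: "a \<le> b"
    and y: "\<And>u. u \<in> {a..b} \<Longrightarrow> (y has_real_derivative y' u) (at u within {a..b})"
    and s: "\<And>u. u \<in> {a..b} \<Longrightarrow> (s has_real_derivative v u) (at u within {a..b})"
    and cy': "continuous_on {a..b} y'" and cv: "continuous_on {a..b} v"
    and v: "\<And>u. u \<in> {a..b} \<Longrightarrow> 0 < v u"
    and sm: "\<And>u. u \<in> {a..b} \<Longrightarrow> \<bar>w * (s u - m)\<bar> < pi / 2"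
  shows "w\<^sup>2 * integral {a..b} (\<lambda>u. v u * (y u)\<^sup>2)
    \<le> integral {a..b} (\<lambda>u. (y' u)\<^sup>2 / v u)
       + w * tan (w * (s b - m)) * (y b)\<^sup>2 - w * tan (w * (s a - m)) * (y a)\<^sup>2"
proof -
  define q where "q u = w * tan (w * (s u - m))" for u
  have cos0: "cos (w * (s u - m)) \<noteq> 0" if "u \<in> {a..b}" for u
    using sm[OF that] cos_gt_zero_pi[of "w * (s u - m)"] unfolding abs_less_iff by linarith
  have cy: "continuous_on {a..b} y" by (rule DERIV_continuous_on[OF y])
  have cs: "continuous_on {a..b} s" by (rule DERIV_continuous_on[OF s])
  have q: "(q has_real_derivative v u * (w\<^sup>2 + (q u)\<^sup>2)) (at u within {a..b})" if "u \<in> {a..b}" for u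
  proof -
    have "(q has_real_derivative w * (inverse ((cos (w * (s u - m)))\<^sup>2) * (w * v u))) (at u within {a..b})"
      unfolding q_def using cos0[OF that]
      by (auto intro!: derivative_eq_intros s that simp: divide_simps)
    moreover have "inverse ((cos (w * (s u - m)))\<^sup>2) = 1 + (tan (w * (s u - m)))\<^sup>2"
      using tan_sec[OF cos0[OF that]] by (simp add: power_inverse)
    ultimately show ?thesis by (simp add: q_def power2_eq_square algebra_simps)
  qed
  have cq: "continuous_on {a..b} q" by (rule DERIV_continuous_on[OF q])
  have v0: "v u \<noteq> 0" if "u \<in> {a..b}" for u using v[OF that] by simp
  note ints = integrable_continuous_real continuous_intros cy cy' cv cq
  have ftc: "((\<lambda>u. v u * (w\<^sup>2 + (q u)\<^sup>2) * (y u)\<^sup>2 + q u * (2 * y u * y' u))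
      has_integral q b * (y b)\<^sup>2 - q a * (y a)\<^sup>2) {a..b}"
  proof (rule fundamental_theorem_of_calculus[OF ab])
    fix u assume u: "u \<in> {a..b}"
    have "((\<lambda>u. q u * (y u)\<^sup>2) has_real_derivative
        v u * (w\<^sup>2 + (q u)\<^sup>2) * (y u)\<^sup>2 + (2 * y u * y' u) * q u) (at u within {a..b})"
      using DERIV_mult[OF q[OF u] DERIV_power[OF y[OF u], of 2]] by (simp add: ac_simps)
    then show "((\<lambda>u. q u * (y u)\<^sup>2) has_vector_derivative
        v u * (w\<^sup>2 + (q u)\<^sup>2) * (y u)\<^sup>2 + q u * (2 * y u * y' u)) (at u within {a..b})"
      by (simp add: has_real_derivative_iff_has_vector_derivative mult.commute)
  qed
  have "0 \<le> integral {a..b} (\<lambda>u. (y' u + q u * v u * y u)\<^sup>2 / v u)"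
    by (intro integral_nonneg ints) (auto simp: v0 intro!: divide_nonneg_pos v)
  also have "\<dots> = integral {a..b} (\<lambda>u. (y' u)\<^sup>2 / v u
      + (v u * (w\<^sup>2 + (q u)\<^sup>2) * (y u)\<^sup>2 + q u * (2 * y u * y' u)) - w\<^sup>2 * (v u * (y u)\<^sup>2))"
    by (intro integral_cong) (auto simp: v0 power2_eq_square field_simps)
  also have "\<dots> = integral {a..b} (\<lambda>u. (y' u)\<^sup>2 / v u) + (q b * (y b)\<^sup>2 - q a * (y a)\<^sup>2)
      - w\<^sup>2 * integral {a..b} (\<lambda>u. v u * (y u)\<^sup>2)"
    by (rule integral_unique)
      (intro has_integral_add has_integral_diff has_integral_mult_right integrable_integral ftc
        integrable_continuous_real continuous_intros cy cy' cv; auto simp: v0)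
  finally show ?thesis by (simp add: q_def)
qed

text \<open>In the parameter \<open>x = s u\<close> the difference \<open>h\<close> of values half a
  period apart satisfies \<open>h (L / 2) = - h 0\<close>, because \<open>y\<close> closes up; so
  \<open>h\<close> has a zero.\<close>

lemma exists_equal_values_half_apart:
  fixes y s :: "real \<Rightarrow> real"
  assumes cy: "continuous_on {0..1} y" and cs: "continuous_on {0..1} s"
    and mono: "strict_mono_on {0..1} s"
    and s01: "s 0 = 0" "s 1 = L" and y01: "y 0 = y 1"
  obtains u0 u1 where "0 \<le> u0" "u0 \<le> u1" "u1 \<le> 1" "s u1 = s u0 + L / 2" "y u0 = y u1"
proof -
  have inj: "inj_on s {0..1}" using mono strict_mono_on_imp_inj_on by blast
  have L: "0 < L" using strict_mono_onD[OF mono, of 0 1] s01 by simp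
  have im: "s ` {0..1} = {0..L}"
  proof (intro equalityI subsetI)
    fix x assume "x \<in> s ` {0..1}"
    then obtain u where "u \<in> {0..1}" "x = s u" by auto
    then show "x \<in> {0..L}"
      using strict_mono_on_leD[OF mono, of 0 u] strict_mono_on_leD[OF mono, of u 1] s01 by auto
  next
    fix x assume "x \<in> {0..L}"
    then show "x \<in> s ` {0..1}" using IVT'[of s 0 x 1] cs s01 by auto
  qed
  define g where "g = inv_into {0..1} s"
  have gs: "g (s u) = u" if "u \<in> {0..1}" for u
    using inj that by (simp add: g_def)
  have sg: "s (g x) = x" "g x \<in> {0..1}" if "x \<in> {0..L}" for x
    using that im f_inv_into_f[of x s "{0..1}"] inv_into_into[of x s "{0..1}"] unfolding g_def by blast+
  have cg: "continuous_on {0..L} g"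
    using continuous_on_inv[OF cs, of g] gs im by auto
  have yg: "continuous_on {0..L} (\<lambda>x. y (g x))"
    by (rule continuous_on_compose2[OF cy cg]) (use sg in auto)
  define h where "h x = y (g (x + L / 2)) - y (g x)" for x
  have ch: "continuous_on {0..L/2} h"
    unfolding h_def
    by (intro continuous_intros continuous_on_compose2[OF yg]) auto
  have ends: "g 0 = 0" "g L = 1" using gs[of 0] gs[of 1] s01 by auto
  have "h (L / 2) = - h 0" unfolding h_def using ends y01 by simp
  then have "\<exists>x. 0 \<le> x \<and> x \<le> L / 2 \<and> h x = 0"
    using IVT'[of h 0 0 "L/2"] IVT2'[of h "L/2" 0 0] ch L by (cases "h 0 \<le> 0") auto
  then obtain x where x: "0 \<le> x" "x \<le> L / 2" "h x = 0" by blast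
  have le: "g x \<le> g (x + L / 2)"
    using strict_mono_onD[OF mono, of "g (x + L/2)" "g x"] sg[of x] sg[of "x + L/2"] x L
    by (fastforce simp: not_le[symmetric])
  show ?thesis
    by (rule that[of "g x" "g (x + L / 2)"]) (use x L sg[of x] sg[of "x + L/2"] le in \<open>auto simp: h_def\<close>)
qed

text \<open>Cut the loop at two points half a period apart where \<open>y\<close> takes the same value \<open>a\<close>: on both
  halves \<open>y - a\<close> vanishes at the ends, and replacing \<open>y\<close> by \<open>y - a\<close> only increases the left-hand side.\<close>

lemma weighted_Wirtinger:
  fixes y y' s v :: "real \<Rightarrow> real"
  assumes y: "\<And>u. u \<in> {0..1} \<Longrightarrow> (y has_real_derivative y' u) (at u within {0..1})"
    and s: "\<And>u. u \<in> {0..1} \<Longrightarrow> (s has_real_derivative v u) (at u within {0..1})"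
    and cy': "continuous_on {0..1} y'" and cv: "continuous_on {0..1} v"
    and v: "\<And>u. u \<in> {0..1} \<Longrightarrow> 0 < v u"
    and s01: "s 0 = 0" "s 1 = L" and y01: "y 0 = y 1"
    and mean: "integral {0..1} (\<lambda>u. v u * y u) = 0"
  shows "(2 * pi / L)\<^sup>2 * integral {0..1} (\<lambda>u. v u * (y u)\<^sup>2) \<le> integral {0..1} (\<lambda>u. (y' u)\<^sup>2 / v u)"
proof -
  have cy: "continuous_on {0..1} y" by (rule DERIV_continuous_on[OF y])
  have cs: "continuous_on {0..1} s" by (rule DERIV_continuous_on[OF s])
  have mono: "strict_mono_on {0..1} s"
  proof (rule strict_mono_onI)
    fix a b :: real assume ab: "a \<in> {0..1}" "b \<in> {0..1}" "a < b"
    show "s a < s b"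
    proof (rule DERIV_pos_imp_increasing_open[OF ab(3)])
      fix x assume "a < x" "x < b"
      then have "x \<in> {0<..<1}" using ab by auto
      then have "(s has_real_derivative v x) (at x)"
        using s[of x] at_within_interior[of x "{0..1}"] by auto
      then show "\<exists>y. (s has_real_derivative y) (at x) \<and> 0 < y"
        using v[of x] \<open>x \<in> {0<..<1}\<close> by auto
    qed (rule continuous_on_subset[OF cs], use ab in auto)
  qed
  have L: "0 < L" using strict_mono_onD[OF mono, of 0 1] s01 by simp
  obtain u0 u1 where u: "0 \<le> u0" "u0 \<le> u1" "u1 \<le> 1" "s u1 = s u0 + L / 2" "y u0 = y u1"
    using exists_equal_values_half_apart[OF cy cs mono s01 y01] by blast
  define a where "a = y u0"
  define z where "z u = y u - a" for u
  have z: "(z has_real_derivative y' u) (at u within {0..1})" if "u \<in> {0..1}" for u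
    unfolding z_def using y[OF that] by (auto intro!: derivative_eq_intros)
  have cz: "continuous_on {0..1} z" by (rule DERIV_continuous_on[OF z])
  have v0: "v u \<noteq> 0" if "u \<in> {0..1}" for u using v[OF that] by simp
  note ints = integrable_continuous_real continuous_intros cy cy' cv cz
  have smono: "s p \<le> s q" if "p \<in> {0..1}" "q \<in> {0..1}" "p \<le> q" for p q
    using strict_mono_on_leD[OF mono that] .
  have iz: "(\<lambda>u. v u * (z u)\<^sup>2) integrable_on {0..1}"
    and iy: "(\<lambda>u. (y' u)\<^sup>2 / v u) integrable_on {0..1}" by (intro ints; auto simp: v0)+
  have split: "integral {0..1} f = integral {0..u0} f + integral {u0..u1} f + integral {u1..1} f"
    if "f integrable_on {0..1}" for f :: "real \<Rightarrow> real"
  proof -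
    have "f integrable_on {u0..1}" using integrable_subinterval_real[OF that, of u0 1] u by auto
    from Henstock_Kurzweil_Integration.integral_combine[OF _ _ this, of u1]
      Henstock_Kurzweil_Integration.integral_combine[OF _ _ that, of u0] u
    show ?thesis by simp
  qed
  define Az where "Az = integral {0..1} (\<lambda>u. v u * (z u)\<^sup>2)"
  define By where "By = integral {0..1} (\<lambda>u. (y' u)\<^sup>2 / v u)"
  \<comment> \<open>Each half has length \<open>L / 2\<close>, so the distance from its midpoint is
    at most \<open>L / 4\<close> and the tangent stays finite for \<open>w\<close> below
    \<open>2 * pi / L\<close>. The critical value is reached by a limit afterwards.\<close>
  have main: "w\<^sup>2 * Az \<le> By" if w: "0 < w" "w < 2 * pi / L" for w
  proof -
    have bnd: "\<bar>w * d\<bar> < pi / 2" if "\<bar>d\<bar> \<le> L / 4" for d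
    proof -
      have "\<bar>w * d\<bar> = w * \<bar>d\<bar>" using w by (simp add: abs_mult)
      also have "\<dots> \<le> w * (L / 4)" using w that by (intro mult_left_mono) auto
      also have "\<dots> < pi / 2" using w L by (simp add: field_simps)
      finally show ?thesis .
    qed
    have piece: "w\<^sup>2 * integral {p..q} (\<lambda>u. v u * (z u)\<^sup>2)
      \<le> integral {p..q} (\<lambda>u. (y' u)\<^sup>2 / v u)
       + w * tan (w * (s q - m)) * (z q)\<^sup>2 - w * tan (w * (s p - m)) * (z p)\<^sup>2"
      if "0 \<le> p" "p \<le> q" "q \<le> 1" "s q - m \<le> L / 4" "m - s p \<le> L / 4" for p q m
    proof (rule weighted_Wirtinger_interval)
      fix u assume "u \<in> {p..q}"
      then have "s p \<le> s u" "s u \<le> s q" using that by (auto intro!: smono)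
      then show "\<bar>w * (s u - m)\<bar> < pi / 2"
        using that by (intro bnd) linarith
    qed (use that v in \<open>auto intro: continuous_on_subset[OF cv] continuous_on_subset[OF cy']
          DERIV_subset[OF z] DERIV_subset[OF s]\<close>)
    have z01: "z u0 = 0" "z u1 = 0" "z 1 = z 0" using u y01 by (auto simp: z_def a_def)
    have b: "s u0 \<le> L / 2" "0 \<le> s u0" using smono[of u1 1] smono[of 0 u0] u s01 by auto
    \<comment> \<open>The first and the last piece together form the half that wraps around the base
      point. Their midpoints \<open>s u0 - L / 4\<close> and \<open>s u0 + 3 * L / 4\<close> differ
      by the period \<open>L\<close>, so the boundary terms at 0 and 1 cancel.\<close>
    have "w\<^sup>2 * integral {0..u0} (\<lambda>u. v u * (z u)\<^sup>2)
      \<le> integral {0..u0} (\<lambda>u. (y' u)\<^sup>2 / v u) - w * tan (w * (L / 4 - s u0)) * (z 0)\<^sup>2"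
      using piece[of 0 u0 "s u0 - L / 4"] u b z01 s01 by simp
    moreover have "w\<^sup>2 * integral {u0..u1} (\<lambda>u. v u * (z u)\<^sup>2)
      \<le> integral {u0..u1} (\<lambda>u. (y' u)\<^sup>2 / v u)"
      using piece[of u0 u1 "s u0 + L / 4"] u b z01 s01 by simp
    moreover have "w\<^sup>2 * integral {u1..1} (\<lambda>u. v u * (z u)\<^sup>2)
      \<le> integral {u1..1} (\<lambda>u. (y' u)\<^sup>2 / v u) + w * tan (w * (L / 4 - s u0)) * (z 0)\<^sup>2"
      using piece[of u1 1 "s u0 + 3 * L / 4"] u b z01 s01 by (simp add: algebra_simps)
    ultimately show ?thesis
      unfolding Az_def By_def split[OF iz] split[OF iy] by (simp add: algebra_simps)
  qed
  have "(2 * pi / L)\<^sup>2 * Az \<le> By"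
  proof (rule tendsto_upperbound)
    show "((\<lambda>w. w\<^sup>2 * Az) \<longlongrightarrow> (2 * pi / L)\<^sup>2 * Az) (at_left (2 * pi / L))"
      by (intro tendsto_intros)
    show "\<forall>\<^sub>F w in at_left (2 * pi / L). w\<^sup>2 * Az \<le> By"
      using eventually_at_left_real[of 0 "2 * pi / L"] L
      by (auto intro: main elim!: eventually_mono)
  qed auto
  moreover have "integral {0..1} (\<lambda>u. v u * (y u)\<^sup>2) \<le> Az"
  proof -
    have "Az = integral {0..1} (\<lambda>u. v u * (y u)\<^sup>2 - (2 * a) * (v u * y u) + a\<^sup>2 * v u)"
      unfolding Az_def z_def by (intro integral_cong) (auto simp: power2_eq_square algebra_simps)
    also have "\<dots> = integral {0..1} (\<lambda>u. v u * (y u)\<^sup>2) - (2 * a) * integral {0..1} (\<lambda>u. v u * y u)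
       + a\<^sup>2 * integral {0..1} v"
      by (subst integral_add integral_diff; (intro ints)?)+ simp
    finally have "Az = integral {0..1} (\<lambda>u. v u * (y u)\<^sup>2) + a\<^sup>2 * integral {0..1} v"
      using mean by simp
    moreover have "0 \<le> integral {0..1} v"
      by (rule integral_nonneg) (use v cv in \<open>auto intro: integrable_continuous_real less_imp_le\<close>)
    ultimately show ?thesis by simp
  qed
  ultimately show ?thesis
    unfolding By_def by (meson mult_left_mono order_trans zero_le_power2)
qed

subsection \<open>Geometry of a closed curve\<close>

text \<open>Throughout, \<open>P\<close> and \<open>S\<close> stand for the first and second derivative of a curve \<open>Y\<close>, and \<open>j\<close> is
  \<open>\<i>\<close> times the orientation sign, so that \<open>j * sgn (P u)\<close> is the unit normal.\<close>

definition len :: "(real \<Rightarrow> complex) \<Rightarrow> real" where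
  "len P = integral {0..1} (\<lambda>u. norm (P u))"

text \<open>Signed area: positive for a simple loop whose normal \<open>j * sgn (P u)\<close> points
  inward.\<close>

definition area :: "complex \<Rightarrow> (real \<Rightarrow> complex) \<Rightarrow> (real \<Rightarrow> complex) \<Rightarrow> real" where
  "area j Y P = integral {0..1} (\<lambda>u. (j * Y u) \<bullet> P u) / 2"

text \<open>Centroid of the curve with respect to arc length rather than of the enclosed region, so
  that both coordinates of \<open>Y - ctr Y P\<close> have the zero mean that Wirtinger's inequality
  asks for.\<close>

definition ctr :: "(real \<Rightarrow> complex) \<Rightarrow> (real \<Rightarrow> complex) \<Rightarrow> complex" where
  "ctr Y P = (1 / len P) *\<^sub>R integral {0..1} (\<lambda>u. norm (P u) *\<^sub>R Y u)"

definition kap :: "complex \<Rightarrow> (real \<Rightarrow> complex) \<Rightarrow> (real \<Rightarrow> complex) \<Rightarrow> real \<Rightarrow> real" where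
  "kap j P S u = (S u \<bullet> (j * sgn (P u))) / (norm (P u))\<^sup>2"

text \<open>Normal speed of Gage's flow.\<close>

definition frc :: "complex \<Rightarrow> (real \<Rightarrow> complex) \<Rightarrow> (real \<Rightarrow> complex) \<Rightarrow> real \<Rightarrow> real" where
  "frc j P S u = kap j P S u - 2 * pi / len P"

definition turn :: "complex \<Rightarrow> (real \<Rightarrow> complex) \<Rightarrow> (real \<Rightarrow> complex) \<Rightarrow> real" where
  "turn j P S = integral {0..1} (\<lambda>u. kap j P S u * norm (P u))"

definition ener :: "complex \<Rightarrow> (real \<Rightarrow> complex) \<Rightarrow> (real \<Rightarrow> complex) \<Rightarrow> real" where
  "ener j P S = integral {0..1} (\<lambda>u. (frc j P S u)\<^sup>2 * norm (P u))"

text \<open>Split \<open>S\<close> along the orthonormal frame \<open>sgn (P u)\<close>,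
  \<open>j * sgn (P u)\<close>: differentiating \<open>inverse (norm (P u))\<close> cancels the
  tangential component, and the Frenet formula remains.\<close>

lemma sgn_complex_has_vector_derivative:
  fixes P :: "real \<Rightarrow> complex"
  assumes P: "(P has_vector_derivative S) (at u)" and P0: "P u \<noteq> 0" and j: "j = \<i> \<or> j = - \<i>"
  shows "((\<lambda>u. sgn (P u)) has_vector_derivative
      ((S \<bullet> (j * sgn (P u))) / norm (P u)) *\<^sub>R (j * sgn (P u))) (at u)"
proof -
  have n: "((\<lambda>u. norm (P u)) has_real_derivative S \<bullet> sgn (P u)) (at u)"
    unfolding has_field_derivative_def
    using has_derivative_compose[OF P[unfolded has_vector_derivative_def] has_derivative_norm[OF P0]]
    by (simp add: mult_commute_abs)
  have "((\<lambda>u. inverse (norm (P u)) *\<^sub>R P u) has_vector_derivative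
      inverse (norm (P u)) *\<^sub>R S + (- (inverse (norm (P u)) * (S \<bullet> sgn (P u)) * inverse (norm (P u)))) *\<^sub>R P u) (at u)"
    using P0 by (intro has_vector_derivative_scaleR P DERIV_inverse' n) auto
  moreover have "S = (S \<bullet> sgn (P u)) *\<^sub>R sgn (P u) + (S \<bullet> (j * sgn (P u))) *\<^sub>R (j * sgn (P u))"
  proof -
    define T where "T = sgn (P u)"
    have "(Re T)\<^sup>2 + (Im T)\<^sup>2 = 1"
      using P0 by (simp add: T_def norm_sgn del: Re_sgn Im_sgn flip: cmod_power2)
    then have *: "Re T * Re T = 1 - Im T * Im T" by (simp add: power2_eq_square)
    have "Re S = Re S * (Re T * Re T + Im T * Im T)" "Im S = Im S * (Re T * Re T + Im T * Im T)"
      using * by auto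
    then show ?thesis using j unfolding T_def[symmetric]
      by (auto simp: complex_eq_iff inner_complex_def algebra_simps)
  qed
  then have "inverse (norm (P u)) *\<^sub>R S = inverse (norm (P u)) *\<^sub>R ((S \<bullet> sgn (P u)) *\<^sub>R sgn (P u)
      + (S \<bullet> (j * sgn (P u))) *\<^sub>R (j * sgn (P u)))"
    by simp
  ultimately show ?thesis
    by (simp add: sgn_div_norm scaleR_add_right divide_inverse ac_simps)
qed

text \<open>A single time slice of the flow: an immersed loop, possibly with self-intersections. The
  two endpoint conditions remove the boundary terms when integrating over a period.\<close>

locale closed_loop =
  fixes Y P S :: "real \<Rightarrow> complex" and j :: complex
  assumes Y: "\<And>u. (Y has_vector_derivative P u) (at u)"
    and P: "\<And>u. (P has_vector_derivative S u) (at u)"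
    and cS: "continuous_on UNIV S"
    and P0: "\<And>u. P u \<noteq> 0"
    and Y01: "Y 1 = Y 0" and P01: "P 1 = P 0"
    and j: "j = \<i> \<or> j = - \<i>"
begin

abbreviation v where "v u \<equiv> norm (P u)"
abbreviation T where "T u \<equiv> sgn (P u)"
abbreviation N where "N u \<equiv> j * sgn (P u)"
abbreviation L where "L \<equiv> len P"
abbreviation A where "A \<equiv> area j Y P"
abbreviation c where "c \<equiv> ctr Y P"
abbreviation k where "k \<equiv> kap j P S"
abbreviation f where "f \<equiv> frc j P S"
definition arc where "arc u = integral {0..u} v"
text \<open>Hurwitz's square. It vanishes on a circle about \<open>c\<close> that is traversed once
  with \<open>N\<close> pointing inward: there \<open>Y - c\<close> is \<open>- L / (2 * pi)\<close>
  times \<open>N\<close>, and applying \<open>j\<close> gives a multiple of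
  \<open>T\<close>.\<close>

definition normal_dev where "normal_dev = integral {0..1} (\<lambda>u. v u * (norm (T u - (2 * pi / L) *\<^sub>R (j * (Y u - c))))\<^sup>2)"

lemma rotation_simps: "(j * x) \<bullet> (j * y) = x \<bullet> y" "x \<bullet> (j * y) = - ((j * x) \<bullet> y)" "(j * x) \<bullet> x = 0"
  "norm (j * x) = norm x" "j * j = -1"
  using j by (auto simp: inner_complex_def norm_mult)

lemma cY [continuous_intros]: "continuous_on X Y"
  by (meson Y continuous_at_imp_continuous_on has_vector_derivative_continuous)

lemma cP [continuous_intros]: "continuous_on X P"
  by (meson P continuous_at_imp_continuous_on has_vector_derivative_continuous)

lemma cS' [continuous_intros]: "continuous_on X S"
  using cS continuous_on_subset by blast

lemma cT [continuous_intros]: "continuous_on X T"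
  unfolding sgn_div_norm by (intro continuous_intros) (simp add: P0)

lemma ck [continuous_intros]: "continuous_on X k"
  unfolding kap_def by (intro continuous_intros) (simp add: P0)

lemma cf [continuous_intros]: "continuous_on X f"
  unfolding frc_def by (intro continuous_intros)

lemma v_pos: "0 < v u" by (simp add: P0)

lemma norm_T: "norm (T u) = 1" by (simp add: norm_sgn P0)

lemma vT: "v u *\<^sub>R T u = P u" by (simp add: sgn_div_norm P0)

lemma arc: "(arc has_real_derivative v u) (at u within {0..1})" if "u \<in> {0..1}"
  unfolding arc_def has_real_derivative_iff_has_vector_derivative
  using that by (intro integral_has_vector_derivative continuous_intros)

lemma arc_0: "arc 0 = 0" and arc_1: "arc 1 = L"
  by (auto simp: arc_def len_def)

lemma c_arc: "continuous_on {0..1} arc"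
  by (rule DERIV_continuous_on[OF arc])

lemma L_pos: "0 < L"
proof -
  obtain x where x: "x \<in> {0..1}" "\<And>y. y \<in> {0..1} \<Longrightarrow> v x \<le> v y"
    using continuous_attains_inf[of "{0..1::real}" v] continuous_on_norm[OF cP] by fastforce
  have "v x = integral {0..1::real} (\<lambda>_. v x)" by simp
  also have "\<dots> \<le> L" unfolding len_def
    by (rule integral_le) (auto intro!: integrable_continuous_real continuous_intros x(2))
  finally show ?thesis by (rule less_le_trans[OF v_pos])
qed

lemma L_c: "L *\<^sub>R c = integral {0..1} (\<lambda>u. v u *\<^sub>R Y u)"
  using L_pos by (simp add: ctr_def)

lemma int_P: "integral {0..1} P = 0"
  using fundamental_theorem_of_calculus[of 0 1 Y P] Y Y01
  by (auto intro: integral_unique has_vector_derivative_at_within)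

lemma int_v_Y: "integral {0..1} (\<lambda>u. v u *\<^sub>R (Y u - c)) = 0"
proof -
  have "integral {0..1} (\<lambda>u. v u *\<^sub>R (Y u - c)) =
    integral {0..1} (\<lambda>u. v u *\<^sub>R Y u) - integral {0..1} (\<lambda>u. v u *\<^sub>R c)"
    unfolding scaleR_diff_right
    by (intro integral_diff integrable_continuous_real continuous_intros)
  also have "integral {0..1} (\<lambda>u. v u *\<^sub>R c) = L *\<^sub>R c"
    unfolding len_def
    by (rule integral_unique)
      (intro has_integral_scaleR_left integrable_integral integrable_continuous_real continuous_intros)
  finally show ?thesis using L_c by simp
qed

section \<open>The isoperimetric inequality and its stability\<close>

text \<open>Apply \<open>weighted_Wirtinger\<close> to the real and the imaginary part of
  \<open>Y - c\<close>. The right-hand sides add up to \<open>L\<close> because the squared parts of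
  \<open>P u\<close> add up to the square of \<open>v u\<close>.\<close>

lemma Wirtinger_loop: "(2 * pi / L)\<^sup>2 * integral {0..1} (\<lambda>u. v u * (norm (Y u - c))\<^sup>2) \<le> L"
proof -
  have 1: "(2 * pi / L)\<^sup>2 * integral {0..1} (\<lambda>u. v u * (h (Y u - c))\<^sup>2)
      \<le> integral {0..1} (\<lambda>u. (h (P u))\<^sup>2 / v u)"
    if h: "bounded_linear h" for h :: "complex \<Rightarrow> real"
  proof (rule weighted_Wirtinger[OF _ arc])
    interpret bounded_linear h by fact
    note [continuous_intros] = bounded_linear.continuous_on[OF h]
    show "((\<lambda>u. h (Y u - c)) has_real_derivative h (P u)) (at u within {0..1})" for u
      unfolding has_real_derivative_iff_has_vector_derivative
      using bounded_linear.has_vector_derivative[OF h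
          has_vector_derivative_diff[OF has_vector_derivative_at_within[OF Y] has_vector_derivative_const]]
      by simp
    have "integral {0..1} (h \<circ> (\<lambda>u. v u *\<^sub>R (Y u - c))) = h (integral {0..1} (\<lambda>u. v u *\<^sub>R (Y u - c)))"
      by (intro integral_linear h integrable_continuous_real continuous_intros)
    then show "integral {0..1} (\<lambda>u. v u * h (Y u - c)) = 0"
      by (simp add: o_def int_v_Y scaleR zero)
  qed (auto simp: arc_0 arc_1 Y01 P0 intro!: continuous_intros bounded_linear.continuous_on[OF h])
  have "integral {0..1} (\<lambda>u. v u * (norm (Y u - c))\<^sup>2)
     = integral {0..1} (\<lambda>u. v u * (Re (Y u - c))\<^sup>2 + v u * (Im (Y u - c))\<^sup>2)"
    by (simp only: cmod_power2 distrib_left)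
  also have "\<dots> = integral {0..1} (\<lambda>u. v u * (Re (Y u - c))\<^sup>2)
     + integral {0..1} (\<lambda>u. v u * (Im (Y u - c))\<^sup>2)"
    by (intro integral_add integrable_continuous_real continuous_intros)
  finally have "(2 * pi / L)\<^sup>2 * integral {0..1} (\<lambda>u. v u * (norm (Y u - c))\<^sup>2)
     = (2 * pi / L)\<^sup>2 * integral {0..1} (\<lambda>u. v u * (Re (Y u - c))\<^sup>2)
     + (2 * pi / L)\<^sup>2 * integral {0..1} (\<lambda>u. v u * (Im (Y u - c))\<^sup>2)"
    by (simp only: distrib_left)
  also have "\<dots> \<le> integral {0..1} (\<lambda>u. (Re (P u))\<^sup>2 / v u) + integral {0..1} (\<lambda>u. (Im (P u))\<^sup>2 / v u)"
    by (intro add_mono 1 bounded_linear_Re bounded_linear_Im)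
  also have "\<dots> = integral {0..1} (\<lambda>u. (Re (P u))\<^sup>2 / v u + (Im (P u))\<^sup>2 / v u)"
    by (rule integral_add[symmetric]) (intro integrable_continuous_real continuous_intros; simp add: P0)+
  also have "\<dots> = L" unfolding len_def
    by (intro integral_cong) (simp add: P0 flip: add_divide_distrib cmod_power2, simp add: power2_eq_square)
  finally show ?thesis .
qed

text \<open>The area is invariant under translation, since \<open>P\<close> integrates to zero over
  the loop.\<close>

lemma int_jY_P: "integral {0..1} (\<lambda>u. (j * (Y u - c)) \<bullet> P u) = 2 * A"
proof -
  have "integral {0..1} (\<lambda>u. (j * (Y u - c)) \<bullet> P u) =
      integral {0..1} (\<lambda>u. (j * Y u) \<bullet> P u) - integral {0..1} (\<lambda>u. (j * c) \<bullet> P u)"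
    unfolding right_diff_distrib inner_diff_left
    by (intro integral_diff integrable_continuous_real continuous_intros)
  also have "integral {0..1} (\<lambda>u. (j * c) \<bullet> P u) = (j * c) \<bullet> integral {0..1} P"
    using integral_linear[of P "{0..1}" "\<lambda>x. (j * c) \<bullet> x"]
    by (simp add: o_def bounded_linear_inner_right integrable_continuous_real cP)
  finally show ?thesis by (simp add: area_def int_P)
qed

text \<open>Expanding the square, the tangent contributes \<open>L\<close>, the cross term
  \<open>- 8 * pi * A / L\<close>, and the last term at most \<open>L\<close> by
  \<open>Wirtinger_loop\<close>.\<close>

lemma normal_dev_le: "normal_dev \<le> 2 / L * (L\<^sup>2 - 4 * pi * A)"
proof -
  have "normal_dev = integral {0..1} (\<lambda>u. v u - (4 * pi / L) * ((j * (Y u - c)) \<bullet> P u)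
      + (2 * pi / L)\<^sup>2 * (v u * (norm (Y u - c))\<^sup>2))"
    unfolding normal_dev_def
  proof (intro integral_cong)
    fix u
    let ?Z = "j * (Y u - c)" and ?w = "2 * pi / L"
    have "v u * (norm (T u - ?w *\<^sub>R ?Z))\<^sup>2 = v u * ((norm (T u))\<^sup>2 - 2 * ?w * (T u \<bullet> ?Z) + ?w\<^sup>2 * (norm ?Z)\<^sup>2)"
      unfolding power2_norm_eq_inner by (simp add: inner_diff algebra_simps inner_commute power2_eq_square)
    also have "\<dots> = v u - 2 * ?w * (?Z \<bullet> (v u *\<^sub>R T u)) + ?w\<^sup>2 * (v u * (norm (Y u - c))\<^sup>2)"
      by (simp only: norm_T rotation_simps(4)) (simp add: algebra_simps inner_commute)
    finally show "v u * (norm (T u - ?w *\<^sub>R ?Z))\<^sup>2 = v u - (4 * pi / L) * (?Z \<bullet> P u)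
      + ?w\<^sup>2 * (v u * (norm (Y u - c))\<^sup>2)" by (simp add: vT)
  qed
  also have "\<dots> = L - (4 * pi / L) * (2 * A) + (2 * pi / L)\<^sup>2 * integral {0..1} (\<lambda>u. v u * (norm (Y u - c))\<^sup>2)"
    unfolding int_jY_P[symmetric] len_def
    by (rule integral_unique)
      (intro has_integral_add has_integral_diff has_integral_mult_right integrable_integral
        integrable_continuous_real continuous_intros)
  also have "\<dots> \<le> L - (4 * pi / L) * (2 * A) + L" using Wirtinger_loop by simp
  also have "\<dots> = 2 / L * (L\<^sup>2 - 4 * pi * A)" using L_pos by (simp add: field_simps power2_eq_square)
  finally show ?thesis .
qed

lemma normal_dev_nonneg: "0 \<le> normal_dev"
  unfolding normal_dev_def by (intro integral_nonneg integrable_continuous_real continuous_intros) auto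

lemma isoperimetric: "0 \<le> L\<^sup>2 - 4 * pi * A"
proof -
  have "0 \<le> 2 / L * (L\<^sup>2 - 4 * pi * A)" using normal_dev_le normal_dev_nonneg by simp
  then show ?thesis using L_pos by (simp only: zero_le_mult_iff zero_less_divide_iff) (simp add: zero_le_divide_iff)
qed

lemma weighted_Cauchy_Schwarz:
  assumes "continuous_on {0..1} g"
  shows "(integral {0..1} (\<lambda>u. g u * v u))\<^sup>2 \<le> L * integral {0..1} (\<lambda>u. (g u)\<^sup>2 * v u)"
  using integral_weighted_Cauchy_Schwarz[OF continuous_on_const[of _ 1] assms, of v]
  by (simp add: len_def continuous_on_norm cP)

lemma normal_dev_L1: "integral {0..1} (\<lambda>u. norm (T u - (2 * pi / L) *\<^sub>R (j * (Y u - c))) * v u)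
    \<le> sqrt (2 * (L\<^sup>2 - 4 * pi * A))"
proof (rule real_le_rsqrt)
  have "(integral {0..1} (\<lambda>u. norm (T u - (2 * pi / L) *\<^sub>R (j * (Y u - c))) * v u))\<^sup>2 \<le> L * normal_dev"
    using weighted_Cauchy_Schwarz[of "\<lambda>u. norm (T u - (2 * pi / L) *\<^sub>R (j * (Y u - c)))"]
    unfolding normal_dev_def by (simp add: mult.commute continuous_intros)
  also have "\<dots> \<le> L * (2 / L * (L\<^sup>2 - 4 * pi * A))"
    using normal_dev_le L_pos by (intro mult_left_mono) auto
  finally show "(integral {0..1} (\<lambda>u. norm (T u - (2 * pi / L) *\<^sub>R (j * (Y u - c))) * v u))\<^sup>2
    \<le> 2 * (L\<^sup>2 - 4 * pi * A)" using L_pos by simp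
qed

text \<open>Turning \<open>Y - c\<close> back by the angle that belongs to arc length on a circle of
  length \<open>L\<close> gives \<open>W\<close>. Up to a rotation, its derivative is
  \<open>v\<close> times the deviation integrated in \<open>normal_dev_L1\<close>, so
  \<open>W\<close> stays close to its initial value, which serves as \<open>z\<close>.\<close>

lemma near_circle:
  obtains z where
    "\<And>u. u \<in> {0..1} \<Longrightarrow>
      norm (Y u - c - z * exp (of_real (2 * pi / L * arc u) * j)) \<le> sqrt (2 * (L\<^sup>2 - 4 * pi * A))"
    "\<bar>norm z - L / (2 * pi)\<bar> \<le> 2 * sqrt (2 * (L\<^sup>2 - 4 * pi * A))"
proof -
  let ?w = "2 * pi / L" and ?d = "sqrt (2 * (L\<^sup>2 - 4 * pi * A))"
  define r where "r u = T u - ?w *\<^sub>R (j * (Y u - c))" for u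
  define e where "e x = exp (of_real x * j)" for x
  define W where "W u = e (- ?w * arc u) * (Y u - c)" for u
  have ne: "norm (e x) = 1" for x
    using j by (auto simp: e_def norm_exp_eq_Re)
  have ee: "e x * e (- x) = 1" for x by (simp add: e_def flip: exp_add)
  have cr [continuous_intros]: "continuous_on X r" for X
    unfolding r_def by (intro continuous_intros)
  have nint: "(\<lambda>u. norm (r u) * v u) integrable_on {0..1}"
    by (intro integrable_continuous_real continuous_intros)
  have W': "(W has_vector_derivative e (- ?w * arc u) * (v u *\<^sub>R r u)) (at u within {0..1})"
    if u: "u \<in> {0..1}" for u
  proof -
    have "((\<lambda>u. of_real (- ?w * arc u) * j) has_vector_derivative of_real (- ?w * v u) * j) (at u within {0..1})"
      by (intro has_vector_derivative_mult_left has_vector_derivative_of_real DERIV_cmult arc u)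
    from field_vector_diff_chain_within[OF this, of exp]
    have "((\<lambda>u. e (- ?w * arc u)) has_vector_derivative of_real (- ?w * v u) * j * e (- ?w * arc u)) (at u within {0..1})"
      by (simp add: o_def e_def DERIV_exp[THEN has_field_derivative_at_within])
    from has_vector_derivative_mult[OF this
      has_vector_derivative_diff[OF has_vector_derivative_at_within[OF Y] has_vector_derivative_const]]
    have "(W has_vector_derivative e (- ?w * arc u) * (P u - 0)
        + of_real (- ?w * v u) * j * e (- ?w * arc u) * (Y u - c)) (at u within {0..1})"
      unfolding W_def .
    moreover have "v u *\<^sub>R r u = P u - of_real (?w * v u) * (j * (Y u - c))"
      unfolding r_def by (simp only: scaleR_diff_right vT) (simp add: scaleR_conv_of_real)
    moreover have "E * (p - 0) + of_real (- ?w * x) * j * E * Z = E * (p - of_real (?w * x) * (j * Z))"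
      for x E p Z by (simp add: algebra_simps)
    ultimately show ?thesis by (simp only:)
  qed
  have WW: "norm (W u - W 0) \<le> ?d" if u: "u \<in> {0..1}" for u
  proof -
    have "((\<lambda>x. e (- ?w * arc x) * (v x *\<^sub>R r x)) has_integral W u - W 0) {0..u}"
      using u by (intro fundamental_theorem_of_calculus has_vector_derivative_within_subset[OF W']) auto
    then have "norm (W u - W 0) \<le> integral {0..u} (\<lambda>x. norm (r x) * v x)"
      by (intro integral_norm_bound_integral[of "\<lambda>x. e (- ?w * arc x) * (v x *\<^sub>R r x)" "{0..u}",
            OF _ integrable_continuous_real, THEN order_trans[rotated]])
        (auto simp: norm_mult ne integral_unique intro!: continuous_intros)
    also have "\<dots> \<le> integral {0..1} (\<lambda>x. norm (r x) * v x)"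
      using u by (intro integral_subset_le integrable_continuous_real continuous_intros) auto
    also have "\<dots> \<le> ?d" using normal_dev_L1 by (simp add: r_def)
    finally show ?thesis .
  qed
  have near: "norm (Y u - c - W 0 * e (?w * arc u)) \<le> ?d" if u: "u \<in> {0..1}" for u
  proof -
    have "Y u - c - W 0 * e (?w * arc u) = e (?w * arc u) * (W u - W 0)"
    proof -
      have "y - w * x = x * (x' * y - w)" if "x * x' = 1" for x x' y w :: complex
        using that by (simp add: right_diff_distrib flip: mult.assoc)
      from this[OF ee[of "?w * arc u"]] show ?thesis by (simp add: W_def)
    qed
    then show ?thesis using WW[OF u] by (simp add: norm_mult ne)
  qed
  \<comment> \<open>The radius is found by comparing \<open>norm (T u) = 1\<close> with the length
    of the vector subtracted from \<open>T u\<close> in \<open>r u\<close>. The error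
    \<open>norm (r u)\<close> is controlled only in the mean, hence the integration over the loop
    that follows.\<close>
  have vr: "\<bar>1 - ?w * norm (W 0)\<bar> \<le> norm (r u) + ?w * ?d" if u: "u \<in> {0..1}" for u
  proof -
    have "norm (W 0 * e (?w * arc u)) = norm (W 0)" by (simp add: norm_mult ne)
    then have "\<bar>norm (Y u - c) - norm (W 0)\<bar> \<le> ?d"
      using near[OF u] norm_triangle_ineq3[of "Y u - c" "W 0 * e (?w * arc u)"] by linarith
    then have "?w * \<bar>norm (Y u - c) - norm (W 0)\<bar> \<le> ?w * ?d"
      using L_pos by (intro mult_left_mono) auto
    then have "\<bar>?w * norm (Y u - c) - ?w * norm (W 0)\<bar> \<le> ?w * ?d"
      using L_pos by (simp only: right_diff_distrib[symmetric] abs_mult) simp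
    moreover have "\<bar>norm (T u) - norm (?w *\<^sub>R (j * (Y u - c)))\<bar> \<le> norm (r u)"
      unfolding r_def by (rule norm_triangle_ineq3)
    then have "\<bar>1 - ?w * norm (Y u - c)\<bar> \<le> norm (r u)"
      unfolding norm_T norm_scaleR rotation_simps(4) using L_pos by simp
    ultimately show ?thesis by linarith
  qed
  have "integral {0..1} (\<lambda>u. \<bar>1 - ?w * norm (W 0)\<bar> * v u)
      \<le> integral {0..1} (\<lambda>u. norm (r u) * v u + (?w * ?d) * v u)"
    unfolding distrib_right[symmetric]
    by (intro integral_le integrable_continuous_real continuous_intros mult_right_mono vr) auto
  also have "\<dots> = integral {0..1} (\<lambda>u. norm (r u) * v u) + (?w * ?d) * L"
    unfolding len_def
    by (rule integral_unique) (intro has_integral_add has_integral_mult_right integrable_integral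
        integrable_continuous_real continuous_intros)
  also have "\<dots> \<le> ?d + (?w * ?d) * L" using normal_dev_L1 by (simp add: r_def)
  also have "integral {0..1} (\<lambda>u. \<bar>1 - ?w * norm (W 0)\<bar> * v u) = \<bar>1 - ?w * norm (W 0)\<bar> * L"
    unfolding len_def by (rule integral_mult_right)
  also have "?d + (?w * ?d) * L = ?d * (1 + 2 * pi)" using L_pos by (simp add: field_simps)
  also have "\<bar>1 - ?w * norm (W 0)\<bar> * L = \<bar>(1 - ?w * norm (W 0)) * L\<bar>"
    using L_pos by (simp add: abs_mult)
  also have "(1 - ?w * norm (W 0)) * L = - (2 * pi) * (norm (W 0) - L / (2 * pi))"
    using L_pos by (simp add: field_simps)
  also have "\<bar>\<dots>\<bar> = 2 * pi * \<bar>norm (W 0) - L / (2 * pi)\<bar>" by (simp add: abs_mult)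
  \<comment> \<open>Rounding 1 up to \<open>2 * pi\<close> leaves the plain factor 2 after division
    by \<open>2 * pi\<close>.\<close>
  also have "?d * (1 + 2 * pi) \<le> ?d * (2 * (2 * pi))"
    using pi_gt3 isoperimetric by (intro mult_left_mono) auto
  finally have "\<bar>norm (W 0) - L / (2 * pi)\<bar> \<le> 2 * ?d" by simp
  then show ?thesis using near that[of "W 0"] unfolding e_def by blast
qed

text \<open>The centre is a weighted mean of points of the loop, and any two of these are at most
  \<open>L\<close> apart.\<close>

lemma diameter_bound: "norm (Y u - c) \<le> L" if u: "u \<in> {0..1}"
proof -
  have chord: "norm (Y q - Y p) \<le> L" if "0 \<le> p" "p \<le> q" "q \<le> 1" for p q
  proof -
    have P_int: "(P has_integral Y q - Y p) {p..q}"
      using that Y by (intro fundamental_theorem_of_calculus) (auto intro: has_vector_derivative_at_within)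
    then have "norm (Y q - Y p) = norm (integral {p..q} P)" by (simp add: integral_unique)
    also have "\<dots> \<le> integral {p..q} v"
      by (intro integral_norm_bound_integral integrable_continuous_real continuous_intros) auto
    also have "\<dots> \<le> L" unfolding len_def using that
      by (intro integral_subset_le integrable_continuous_real continuous_intros) auto
    finally show ?thesis .
  qed
  have d: "norm (Y u - Y x) \<le> L" if "x \<in> {0..1}" for x
    using chord[of x u] chord[of u x] u that norm_minus_commute[of "Y u" "Y x"] by (cases "x \<le> u") auto
  have "L *\<^sub>R (Y u - c) = integral {0..1} (\<lambda>x. v x *\<^sub>R (Y u - Y x))"
  proof -
    have "((\<lambda>x. v x *\<^sub>R Y u - v x *\<^sub>R Y x) has_integral L *\<^sub>R Y u - L *\<^sub>R c) {0..1}"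
      unfolding L_c unfolding len_def
      by (intro has_integral_diff has_integral_scaleR_left integrable_integral
        integrable_continuous_real continuous_intros)
    then show ?thesis by (simp add: scaleR_diff_right integral_unique)
  qed
  then have "L * norm (Y u - c) = norm (integral {0..1} (\<lambda>x. v x *\<^sub>R (Y u - Y x)))"
    using L_pos by (metis abs_of_pos norm_scaleR)
  also have "\<dots> \<le> integral {0..1} (\<lambda>x. v x * L)"
    using d by (intro integral_norm_bound_integral integrable_continuous_real continuous_intros)
      (auto intro!: mult_left_mono)
  also have "\<dots> = L * L" unfolding len_def by (rule integral_mult_left)
  finally show ?thesis using L_pos by simp
qed

section \<open>Turning number, energy and the speed of the centre\<close>

text \<open>Turning \<open>T\<close> back by the accumulated angle \<open>a\<close> leaves a
  constant. As \<open>T\<close> closes up, the total angle \<open>a 1\<close> is a multiple of a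
  full turn.\<close>

lemma turn_integer: "\<exists>m::int. turn j P S = 2 * pi * m"
proof -
  define a where "a u = integral {0..u} (\<lambda>u. k u * v u)" for u
  have a: "(a has_real_derivative k u * v u) (at u within {0..1})" if "u \<in> {0..1}" for u
    unfolding a_def has_real_derivative_iff_has_vector_derivative
    using that by (intro integral_has_vector_derivative continuous_intros)
  have T': "(T has_vector_derivative (k u * v u) *\<^sub>R N u) (at u within {0..1})" for u
    using has_vector_derivative_at_within[OF sgn_complex_has_vector_derivative[OF P P0 j]]
    by (simp add: kap_def power2_eq_square P0)
  define W where "W u = exp (of_real (- a u) * j) * T u" for u
  have "(W has_vector_derivative 0) (at u within {0..1})" if u: "u \<in> {0..1}" for u
  proof -
    have "((\<lambda>u. of_real (- a u) * j) has_vector_derivative of_real (- (k u * v u)) * j) (at u within {0..1})"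
      by (intro has_vector_derivative_mult_left has_vector_derivative_of_real DERIV_minus a u)
    from field_vector_diff_chain_within[OF this, of exp]
    have "((\<lambda>u. exp (of_real (- a u) * j)) has_vector_derivative
        of_real (- (k u * v u)) * j * exp (of_real (- a u) * j)) (at u within {0..1})"
      by (simp add: o_def DERIV_exp[THEN has_field_derivative_at_within])
    from has_vector_derivative_mult[OF this T'[of u]]
    show ?thesis unfolding W_def by (simp add: scaleR_conv_of_real algebra_simps)
  qed
  then obtain w where "\<And>u. u \<in> {0..1} \<Longrightarrow> W u = w"
    using has_vector_derivative_zero_constant[of "{0..1::real}" W] by auto
  then have "W 1 = W 0" by simp
  moreover have "T 0 \<noteq> 0" using P0 by (simp add: sgn_zero_iff)
  ultimately have e: "exp (of_real (- a 1) * j) = 1"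
    by (simp add: W_def P01 a_def)
  have "\<exists>m::int. a 1 = 2 * pi * m"
    using j
  proof
    assume "j = \<i>"
    then obtain m :: int where "- a 1 = of_int (2 * m) * pi" using e by (auto simp: exp_eq_1)
    then have "a 1 = - (of_int (2 * m) * pi)" by linarith
    then have "a 1 = 2 * pi * of_int (- m)" by (simp add: mult_ac)
    then show ?thesis by blast
  next
    assume "j = - \<i>"
    then obtain m :: int where "a 1 = of_int (2 * m) * pi" using e by (auto simp: exp_eq_1)
    then have "a 1 = 2 * pi * of_int m" by simp
    then show ?thesis by blast
  qed
  then show ?thesis by (simp add: a_def turn_def)
qed

lemma int_f: "integral {0..1} (\<lambda>u. f u * v u) = turn j P S - 2 * pi"
proof -
  have "((\<lambda>u. k u * v u - 2 * pi / L * v u) has_integral turn j P S - 2 * pi / L * L) {0..1}"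
    unfolding turn_def len_def
    by (intro has_integral_diff has_integral_mult_right integrable_integral
        integrable_continuous_real continuous_intros)
  then show ?thesis using L_pos by (simp add: frc_def left_diff_distrib integral_unique)
qed

text \<open>Substitute \<open>k u = f u + 2 * pi / L\<close> for the first factor. The left-hand
  side is the rate at which the flow shortens the loop.\<close>

lemma dissipation: "integral {0..1} (\<lambda>u. k u * f u * v u) = ener j P S + 2 * pi / L * (turn j P S - 2 * pi)"
proof -
  have "((\<lambda>u. (f u)\<^sup>2 * v u + 2 * pi / L * (f u * v u)) has_integral
      ener j P S + 2 * pi / L * integral {0..1} (\<lambda>u. f u * v u)) {0..1}"
    unfolding ener_def
    by (intro has_integral_add has_integral_mult_right integrable_integral
        integrable_continuous_real continuous_intros)
  moreover have "(f u)\<^sup>2 * v u + 2 * pi / L * (f u * v u) = k u * f u * v u" for u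
    by (simp add: frc_def power2_eq_square algebra_simps)
  ultimately show ?thesis by (simp add: int_f integral_unique)
qed

text \<open>Cauchy-Schwarz against the constant 1, with \<open>int_f\<close>: a turning number other
  than one forces positive energy.\<close>

lemma ener_ge: "(turn j P S - 2 * pi)\<^sup>2 \<le> L * ener j P S"
  using weighted_Cauchy_Schwarz[OF cf] by (simp add: int_f ener_def)

lemma ener_nonneg: "0 \<le> ener j P S"
  unfolding ener_def by (intro integral_nonneg integrable_continuous_real continuous_intros) auto

lemma int_abs_f: "integral {0..1} (\<lambda>u. \<bar>f u\<bar> * v u) \<le> sqrt (L * ener j P S)"
proof (rule real_le_rsqrt)
  show "(integral {0..1} (\<lambda>u. \<bar>f u\<bar> * v u))\<^sup>2 \<le> L * ener j P S"
    using weighted_Cauchy_Schwarz[of "\<lambda>u. \<bar>f u\<bar>"] by (simp add: ener_def continuous_intros)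
qed

text \<open>Pair the support function, shifted by the radius \<open>L / (2 \<pi>)\<close>, with \<open>f\<close>.\<close>

lemma deficit_le_ener:
  assumes turn: "turn j P S = 2 * pi"
  shows "2 * pi\<^sup>2 * (L\<^sup>2 - 4 * pi * A) \<le> L ^ 3 * ener j P S"
proof -
  define Z where "Z u = Y u - c" for u
  define h where "h u = Z u \<bullet> N u + L / (2 * pi)" for u
  have cZ [continuous_intros]: "continuous_on X Z" for X
    unfolding Z_def by (intro continuous_intros)
  have ch [continuous_intros]: "continuous_on X h" for X
    unfolding h_def by (intro continuous_intros) auto
  define D where "D = L\<^sup>2 - 4 * pi * A"
  have D0: "0 \<le> D" using isoperimetric by (simp add: D_def)
  have ZN: "integral {0..1} (\<lambda>u. (Z u \<bullet> N u) * v u) = - 2 * A"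
  proof -
    have "(Z u \<bullet> N u) * v u = - ((j * (Y u - c)) \<bullet> P u)" for u
    proof -
      have "(Z u \<bullet> N u) * v u = - ((j * Z u) \<bullet> (v u *\<^sub>R T u))" by (simp add: rotation_simps(2))
      then show ?thesis by (simp only: vT Z_def)
    qed
    then show ?thesis using int_jY_P by simp
  qed
  \<comment> \<open>Minkowski's formula: integrate the derivative of the inner product of
    \<open>Z\<close> and \<open>T\<close> over the loop.\<close>
  have ZNk: "integral {0..1} (\<lambda>u. (Z u \<bullet> N u) * (k u * v u)) = - L"
  proof -
    have T': "(T has_vector_derivative (k u * v u) *\<^sub>R N u) (at u within {0..1})" for u
      using has_vector_derivative_at_within[OF sgn_complex_has_vector_derivative[OF P P0 j]]
      by (simp add: kap_def power2_eq_square P0)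
    have Z': "(Z has_vector_derivative P u) (at u within {0..1})" for u
      unfolding Z_def
      using has_vector_derivative_diff[OF has_vector_derivative_at_within[OF Y] has_vector_derivative_const]
      by simp
    have PT: "P u \<bullet> T u = v u" for u
      using norm_T[of u] vT[of u] by (metis dot_square_norm inner_scaleR_left mult.right_neutral one_power2)
    have "((\<lambda>u. Z u \<bullet> ((k u * v u) *\<^sub>R N u) + P u \<bullet> T u) has_integral Z 1 \<bullet> T 1 - Z 0 \<bullet> T 0) {0..1}"
      by (intro fundamental_theorem_of_calculus
          bounded_bilinear.has_vector_derivative[OF bounded_bilinear_inner] T' Z') auto
    then have "((\<lambda>u. (Z u \<bullet> N u) * (k u * v u) + v u) has_integral 0) {0..1}"
      by (simp add: PT Z_def Y01 P01 mult.commute)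
    from has_integral_diff[OF this integrable_integral[of v]]
    show ?thesis by (simp add: len_def integrable_continuous_real continuous_intros integral_unique)
  qed
  \<comment> \<open>Multiplying out \<open>h u * f u\<close> with
    \<open>f u = k u - 2 * pi / L\<close>, the integrals \<open>ZNk\<close> and \<open>ZN\<close>
    combine to \<open>- D / L\<close>, while the constant part of \<open>h\<close> drops out by the
    assumption on the turning number.\<close>
  have "((\<lambda>u. (Z u \<bullet> N u) * (k u * v u) - 2 * pi / L * ((Z u \<bullet> N u) * v u)
      + L / (2 * pi) * (f u * v u)) has_integral - L - 2 * pi / L * (- 2 * A) + L / (2 * pi) * (turn j P S - 2 * pi)) {0..1}"
    unfolding ZN[symmetric] ZNk[symmetric] int_f[symmetric]
    by (intro has_integral_add has_integral_diff has_integral_mult_right integrable_integral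
        integrable_continuous_real continuous_intros)
  moreover have "(Z u \<bullet> N u) * (k u * v u) - 2 * pi / L * ((Z u \<bullet> N u) * v u)
      + L / (2 * pi) * (f u * v u) = h u * f u * v u" for u
    by (simp add: h_def frc_def algebra_simps)
  moreover have "- L - 2 * pi / L * (- 2 * A) + L / (2 * pi) * (turn j P S - 2 * pi) = - D / L"
    using L_pos by (simp add: turn D_def field_simps power2_eq_square)
  ultimately have "integral {0..1} (\<lambda>u. h u * f u * v u) = - D / L"
    by (simp add: integral_unique)
  then have 1: "(D / L)\<^sup>2 \<le> integral {0..1} (\<lambda>u. (h u)\<^sup>2 * v u) * ener j P S"
    using integral_weighted_Cauchy_Schwarz[of 0 1 h f v]
    by (simp add: ener_def continuous_intros)
  \<comment> \<open>Up to the factor \<open>2 * pi / L\<close>, \<open>h\<close> is the tangential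
    component of the vector in \<open>normal_dev\<close>; this is why the shift by the radius was
    chosen.\<close>
  have "(2 * pi / L)\<^sup>2 * integral {0..1} (\<lambda>u. (h u)\<^sup>2 * v u) = integral {0..1} (\<lambda>u. (2 * pi / L)\<^sup>2 * ((h u)\<^sup>2 * v u))"
    by (simp add: integral_mult_right)
  also have "\<dots> \<le> normal_dev"
    unfolding normal_dev_def
  proof (intro integral_le integrable_continuous_real continuous_intros)
    fix u
    let ?r = "T u - (2 * pi / L) *\<^sub>R (j * (Y u - c))"
    have TT: "T u \<bullet> T u = 1" using norm_T[of u] by (simp add: dot_square_norm)
    have "?r \<bullet> T u = (2 * pi / L) * h u"
      using L_pos by (simp add: h_def Z_def inner_diff_left TT rotation_simps(2) distrib_left) (simp add: field_simps)
    then have "((2 * pi / L) * h u)\<^sup>2 \<le> (norm ?r)\<^sup>2"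
      using Cauchy_Schwarz_ineq2[of ?r "T u"] norm_T[of u] by (simp add: abs_le_square_iff[symmetric])
    then show "(2 * pi / L)\<^sup>2 * ((h u)\<^sup>2 * v u) \<le> v u * (norm ?r)\<^sup>2"
      using v_pos[of u] by (simp only: power_mult_distrib[of _ "h u"] mult.assoc[symmetric] mult.commute[of "v u"]) (simp add: mult_right_mono)
  qed (simp add: P0)
  also have "normal_dev \<le> 2 / L * D" using normal_dev_le by (simp add: D_def)
  finally have "integral {0..1} (\<lambda>u. (h u)\<^sup>2 * v u) \<le> L * D / (2 * pi\<^sup>2)"
    using L_pos by (simp add: field_simps power2_eq_square)
  \<comment> \<open>The bound on \<open>h\<close> itself carries a factor \<open>D\<close>.
    Cancelling it makes the estimate linear in \<open>D\<close>.\<close>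
  then have "(D / L)\<^sup>2 \<le> L * D / (2 * pi\<^sup>2) * ener j P S"
    using 1 ener_nonneg by (meson mult_right_mono order_trans)
  then have "D * (2 * pi\<^sup>2 * D) \<le> D * (L ^ 3 * ener j P S)"
    using L_pos by (simp add: field_simps power2_eq_square power3_eq_cube)
  then have "2 * pi\<^sup>2 * D \<le> L ^ 3 * ener j P S" if "D \<noteq> 0"
    using that D0 by simp
  moreover have "0 \<le> L ^ 3 * ener j P S" using L_pos ener_nonneg by simp
  ultimately show ?thesis unfolding D_def[symmetric] by (cases "D = 0") auto
qed

text \<open>The vector is \<open>L\<close> times the velocity of the centre under the flow. The
  estimate \<open>\<bar>k u\<bar> \<le> \<bar>f u\<bar> + 2 * pi / L\<close> and
  \<open>diameter_bound\<close> reduce it to integrals of \<open>\<bar>f u\<bar>\<close> and of its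
  square.\<close>

lemma centre_velocity_bound:
  "norm (integral {0..1} (\<lambda>u. (f u * v u) *\<^sub>R N u - (k u * f u * v u) *\<^sub>R (Y u - c)))
    \<le> L * ener j P S + (1 + 2 * pi) * sqrt (L * ener j P S)"
proof -
  have "norm (integral {0..1} (\<lambda>u. (f u * v u) *\<^sub>R N u - (k u * f u * v u) *\<^sub>R (Y u - c)))
    \<le> integral {0..1} (\<lambda>u. (1 + 2 * pi) * (\<bar>f u\<bar> * v u) + L * ((f u)\<^sup>2 * v u))"
  proof (intro integral_norm_bound_integral integrable_continuous_real continuous_intros)
    fix u :: real assume u: "u \<in> {0..1}"
    have "\<bar>k u\<bar> \<le> \<bar>f u\<bar> + 2 * pi / L"
      using L_pos abs_triangle_ineq[of "f u" "2 * pi / L"] by (simp add: frc_def)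
    then have "\<bar>k u\<bar> * norm (Y u - c) \<le> (\<bar>f u\<bar> + 2 * pi / L) * L"
      using diameter_bound[OF u] by (intro mult_mono) auto
    also have "(\<bar>f u\<bar> + 2 * pi / L) * L = \<bar>f u\<bar> * L + 2 * pi"
      using L_pos by (simp add: distrib_right)
    finally have "\<bar>k u\<bar> * norm (Y u - c) \<le> \<bar>f u\<bar> * L + 2 * pi" .
    then have "\<bar>f u\<bar> * v u * (\<bar>k u\<bar> * norm (Y u - c)) \<le> \<bar>f u\<bar> * v u * (\<bar>f u\<bar> * L + 2 * pi)"
      by (intro mult_left_mono) auto
    moreover have "norm ((f u * v u) *\<^sub>R N u - (k u * f u * v u) *\<^sub>R (Y u - c))
      \<le> norm ((f u * v u) *\<^sub>R N u) + norm ((k u * f u * v u) *\<^sub>R (Y u - c))"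
      by (rule norm_triangle_ineq4)
    moreover have "norm ((f u * v u) *\<^sub>R N u) = \<bar>f u\<bar> * v u"
      by (simp only: norm_scaleR rotation_simps(4) norm_T) (simp add: abs_mult)
    moreover have "norm ((k u * f u * v u) *\<^sub>R (Y u - c)) = \<bar>f u\<bar> * v u * (\<bar>k u\<bar> * norm (Y u - c))"
      by (simp add: abs_mult)
    moreover have "\<bar>f u\<bar> * v u * (\<bar>f u\<bar> * L + 2 * pi) = L * ((f u)\<^sup>2 * v u) + 2 * pi * (\<bar>f u\<bar> * v u)"
      by (simp add: power2_eq_square algebra_simps flip: abs_mult)
    ultimately show "norm ((f u * v u) *\<^sub>R N u - (k u * f u * v u) *\<^sub>R (Y u - c))
      \<le> (1 + 2 * pi) * (\<bar>f u\<bar> * v u) + L * ((f u)\<^sup>2 * v u)"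
      unfolding distrib_right mult_1 by linarith
  qed (simp add: P0)
  also have "\<dots> = (1 + 2 * pi) * integral {0..1} (\<lambda>u. \<bar>f u\<bar> * v u) + L * ener j P S"
    unfolding ener_def
    by (rule integral_unique) (intro has_integral_add has_integral_mult_right integrable_integral
        integrable_continuous_real continuous_intros)
  also have "\<dots> \<le> (1 + 2 * pi) * sqrt (L * ener j P S) + L * ener j P S"
    using int_abs_f pi_gt_zero L_pos by (intro add_mono mult_left_mono) auto
  finally show ?thesis by simp
qed

section \<open>Hausdorff distance to a circle\<close>

text \<open>For the second half of Hausdorff closeness: \<open>arc\<close> takes every value between
  0 and \<open>L\<close>, so the circle in \<open>near_circle\<close> is traversed
  completely.\<close>

lemma arc_exp_surj:
  assumes w: "norm w = 1"
  obtains u where "u \<in> {0..1}" "exp (of_real (2 * pi / L * arc u) * j) = w"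
proof -
  have "\<exists>t. 0 \<le> t \<and> t \<le> 2 * pi \<and> exp (of_real t * j) = w"
    using j
  proof
    assume "j = \<i>"
    moreover obtain t where "0 \<le> t" "t < 2 * pi" "w = exp (\<i> * of_real t)"
      using complex_unimodular_polar[OF w] by (metis cis_conv_exp cis.code)
    ultimately show ?thesis by (auto simp: mult.commute)
  next
    assume "j = - \<i>"
    moreover have "norm (cnj w) = 1" using w by simp
    then obtain t where "0 \<le> t" "t < 2 * pi" "cnj w = exp (\<i> * of_real t)"
      using complex_unimodular_polar by (metis cis_conv_exp cis.code)
    then have "w = exp (- (\<i> * of_real t))"
      by (metis complex_cnj_cnj exp_cnj complex_cnj_mult complex_cnj_i complex_cnj_complex_of_real mult_minus_left)
    ultimately show ?thesis using \<open>0 \<le> t\<close> \<open>t < 2 * pi\<close> by (auto simp: mult.commute)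
  qed
  then obtain t where t: "0 \<le> t" "t \<le> 2 * pi" "exp (of_real t * j) = w" by blast
  then have "0 \<le> L * t / (2 * pi)" "L * t / (2 * pi) \<le> L"
    using L_pos by (simp_all add: field_simps)
  then obtain u where "0 \<le> u" "u \<le> 1" "arc u = L * t / (2 * pi)"
    using IVT'[of arc 0 "L * t / (2 * pi)" 1] c_arc arc_0 arc_1 by auto
  moreover from this have "2 * pi / L * arc u = t" using L_pos by simp
  ultimately show ?thesis using that[of u] t by auto
qed

text \<open>The factor 3 adds the distance to the approximating circle and the twofold error of its
  radius in \<open>near_circle\<close>.\<close>

lemma Hausdorff_near_circle:
  assumes d: "d = 3 * sqrt (2 * (L\<^sup>2 - 4 * pi * A))"
  shows "\<And>u. u \<in> {0..1} \<Longrightarrow> \<bar>norm (Y u - c) - L / (2 * pi)\<bar> \<le> d"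
    and "\<And>w. norm w = 1 \<Longrightarrow> \<exists>u. norm (Y u - c - (L / (2 * pi)) *\<^sub>R w) \<le> d"
proof -
  let ?e = "\<lambda>u. exp (of_real (2 * pi / L * arc u) * j)"
  obtain z where z: "\<And>u. u \<in> {0..1} \<Longrightarrow> norm (Y u - c - z * ?e u) \<le> d / 3"
    "\<bar>norm z - L / (2 * pi)\<bar> \<le> 2 * (d / 3)"
    using near_circle unfolding d by (metis nonzero_mult_div_cancel_left zero_neq_numeral)
  fix u :: real assume u: "u \<in> {0..1}"
  have "norm (?e u) = 1" using j by (auto simp: norm_exp_eq_Re)
  then have "norm (z * ?e u) = norm z" by (simp only: norm_mult mult_1_right)
  then have "\<bar>norm (Y u - c) - norm z\<bar> \<le> d / 3"
    using norm_triangle_ineq3[of "Y u - c" "z * ?e u"] z(1)[OF u] by linarith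
  then show "\<bar>norm (Y u - c) - L / (2 * pi)\<bar> \<le> d" using z(2) by linarith
next
  let ?e = "\<lambda>u. exp (of_real (2 * pi / L * arc u) * j)"
  obtain z where z: "\<And>u. u \<in> {0..1} \<Longrightarrow> norm (Y u - c - z * ?e u) \<le> d / 3"
    "\<bar>norm z - L / (2 * pi)\<bar> \<le> 2 * (d / 3)"
    using near_circle unfolding d by (metis nonzero_mult_div_cancel_left zero_neq_numeral)
  fix w :: complex assume w: "norm w = 1"
  \<comment> \<open>\<open>x\<close> cancels the phase of \<open>z\<close>, so that
    \<open>z * x\<close> points in direction \<open>w\<close>; for \<open>z = 0\<close> any unit
    number serves.\<close>
  define x where "x = (if z = 0 then 1 else w * cnj (sgn z))"
  have "norm x = 1" using w by (simp add: x_def norm_mult norm_sgn)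
  moreover have zx: "z * x = norm z *\<^sub>R w"
  proof (cases "z = 0")
    case False
    have "z * cnj (sgn z) = of_real (inverse (norm z)) * (z * cnj z)"
      by (simp add: sgn_div_norm scaleR_conv_of_real)
    also have "\<dots> = of_real (norm z)"
      using False by (simp add: power2_eq_square flip: complex_norm_square)
    finally have "z * cnj (sgn z) = of_real (norm z)" .
    with False show ?thesis by (simp add: x_def scaleR_conv_of_real algebra_simps)
  qed auto
  ultimately obtain u where u: "u \<in> {0..1}" "?e u = x" using arc_exp_surj by blast
  have "Y u - c - (L / (2 * pi)) *\<^sub>R w = (Y u - c - z * ?e u) + (norm z - L / (2 * pi)) *\<^sub>R w"
    by (simp only: u(2) zx scaleR_diff_left) simp
  then have "norm (Y u - c - (L / (2 * pi)) *\<^sub>R w)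
    \<le> norm (Y u - c - z * ?e u) + norm ((norm z - L / (2 * pi)) *\<^sub>R w)"
    using norm_triangle_ineq by metis
  then have "norm (Y u - c - (L / (2 * pi)) *\<^sub>R w) \<le> d"
    using z(1)[OF u(1)] z(2) w by simp
  then show "\<exists>u. norm (Y u - c - (L / (2 * pi)) *\<^sub>R w) \<le> d" ..
qed

end

subsection \<open>Convergence in time\<close>

lemma has_real_derivative_at_interior_atLeast:
  assumes "(g has_real_derivative D) (at t within {a..})" "a < t"
  shows "(g has_real_derivative D) (at (t::real))"
  using assms at_within_interior[of t "{a..}"] by (simp add: interior_real_atLeast)

lemma nonincreasing_on_atLeast:
  fixes g :: "real \<Rightarrow> real"
  assumes g: "\<And>t. a \<le> t \<Longrightarrow> (g has_real_derivative g' t) (at t within {a..})"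
    and g': "\<And>t. a \<le> t \<Longrightarrow> g' t \<le> 0"
    and st: "a \<le> s" "s \<le> t"
  shows "g t \<le> g s"
proof (rule DERIV_nonpos_imp_decreasing_open[OF st(2)])
  show "\<exists>y. (g has_real_derivative y) (at x) \<and> y \<le> 0" if "s < x" "x < t" for x
    using has_real_derivative_at_interior_atLeast[OF g, of x] g'[of x] that st by auto
  have "continuous_on {a..} g" by (rule DERIV_continuous_on[OF g]) auto
  then show "continuous_on {s..t} g" by (rule continuous_on_subset) (use st in auto)
qed

lemma no_nonneg_uniformly_decreasing:
  fixes g :: "real \<Rightarrow> real"
  assumes g: "\<And>t. 0 \<le> t \<Longrightarrow> (g has_real_derivative g' t) (at t within {0..})"
    and g': "\<And>t. 0 \<le> t \<Longrightarrow> g' t \<le> - e" and e: "0 < e"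
    and nonneg: "\<And>t. 0 \<le> t \<Longrightarrow> 0 \<le> g t"
  shows False
proof -
  \<comment> \<open>At this time a decrease at rate \<open>e\<close> has used up
    \<open>g 0 + 1\<close>, which forces \<open>g t \<le> -1\<close>.\<close>
  define t where "t = (g 0 + 1) / e"
  have t: "0 \<le> t" using e nonneg[of 0] by (simp add: t_def)
  have "g t + e * t \<le> g 0 + e * 0"
  proof (rule nonincreasing_on_atLeast[where g = "\<lambda>t. g t + e * t"])
    show "((\<lambda>t. g t + e * t) has_real_derivative g' t + e) (at t within {0..})" if "0 \<le> t" for t
      using that by (auto intro!: derivative_eq_intros g)
    show "g' t + e \<le> 0" if "0 \<le> t" for t using g'[OF that] by simp
  qed (use t in auto)
  then show False using nonneg[OF t] e by (simp add: t_def)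
qed

text \<open>\<open>p\<close> is nondecreasing and bounded, so with its supremum \<open>m\<close> the
  gap \<open>m - p a\<close> bounds all movement of \<open>x\<close> after time \<open>a\<close>.
  Integer times supply a limit, and the same gap extends the convergence to real times.\<close>

lemma convergent_of_increment_bound:
  fixes x :: "real \<Rightarrow> 'a::banach" and p :: "real \<Rightarrow> real"
  assumes inc: "\<And>a b. 0 \<le> a \<Longrightarrow> a \<le> b \<Longrightarrow> norm (x b - x a) \<le> p b - p a"
    and bdd: "\<And>a. 0 \<le> a \<Longrightarrow> p a \<le> B"
  obtains l where "(x \<longlongrightarrow> l) at_top"
proof -
  define m where "m = (SUP a\<in>{0..}. p a)"
  have bd: "bdd_above (p ` {0..})" using bdd by (intro bdd_aboveI2[of _ _ B]) auto
  have pm: "p a \<le> m" if "0 \<le> a" for a unfolding m_def using that by (intro cSUP_upper bd) auto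
  have ev: "\<exists>a\<ge>0. m - p a < e" if "0 < e" for e
  proof -
    have "m - e < m" using that by simp
    then obtain a where "a \<in> {0..}" "m - e < p a"
      unfolding m_def using less_cSUP_iff[OF _ bd, of "m - e"] by (auto simp: m_def)
    then show ?thesis by auto
  qed
  have inc2: "norm (x b - x a) \<le> m - p a" if "0 \<le> a" "a \<le> b" for a b
    using inc[OF that] pm[of b] that by simp
  have "Cauchy (\<lambda>n. x (real n))"
  proof (rule metric_CauchyI)
    fix e :: real assume "0 < e"
    then obtain a where a: "a \<ge> 0" "m - p a < e / 2" using ev[of "e/2"] by auto
    show "\<exists>M. \<forall>i\<ge>M. \<forall>n\<ge>M. dist (x (real i)) (x (real n)) < e"
    proof (intro exI[of _ "nat \<lceil>a\<rceil>"] allI impI)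
      fix i n assume "nat \<lceil>a\<rceil> \<le> i" "nat \<lceil>a\<rceil> \<le> n"
      then have "a \<le> real i" "a \<le> real n" by linarith+
      then have "norm (x i - x a) < e / 2" "norm (x n - x a) < e / 2"
        using inc2[OF a(1), of "real i"] inc2[OF a(1), of "real n"] a(2) by linarith+
      then show "dist (x (real i)) (x (real n)) < e"
        using dist_triangle_half_l[of "x i" "x a" e "x n"] by (simp add: dist_norm)
    qed
  qed
  then obtain l where l: "(\<lambda>n. x (real n)) \<longlonglongrightarrow> l" using Cauchy_convergent convergentD by blast
  have lim: "norm (l - x a) \<le> m - p a" if "0 \<le> a" for a
  proof (rule tendsto_upperbound)
    show "(\<lambda>n. norm (x (real n) - x a)) \<longlonglongrightarrow> norm (l - x a)" by (intro tendsto_intros l)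
    show "\<forall>\<^sub>F n in sequentially. norm (x (real n) - x a) \<le> m - p a"
      using eventually_ge_at_top[of "nat \<lceil>a\<rceil>"]
      by eventually_elim (use that in \<open>auto intro!: inc2 simp: nat_ceiling_le_eq\<close>)
  qed auto
  have "(x \<longlongrightarrow> l) at_top"
  proof (rule tendstoI)
    fix e :: real assume "0 < e"
    then obtain a where a: "a \<ge> 0" "m - p a < e" using ev by blast
    show "\<forall>\<^sub>F b in at_top. dist (x b) l < e"
      using eventually_ge_at_top[of a]
    proof eventually_elim
      case (elim b)
      have "norm (l - x b) \<le> m - p b" using lim a elim by auto
      moreover have "p a \<le> p b" using inc[OF a(1) elim] by (meson diff_ge_0_iff_ge norm_ge_zero order_trans)
      ultimately show ?case using a by (simp add: dist_norm norm_minus_commute)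
    qed
  qed
  then show ?thesis using that by blast
qed

subsection \<open>Evolution along the flow\<close>

text \<open>\<open>W\<close> is given as the space derivative of \<open>V\<close>; that it is also
  the time derivative of \<open>P\<close> is derived in \<open>P_t\<close>.\<close>

locale gage_solution =
  fixes X V P S W :: "real \<Rightarrow> real \<Rightarrow> complex" and j :: complex
  assumes X_t: "\<And>t u. 0 \<le> t \<Longrightarrow> ((\<lambda>s. X s u) has_vector_derivative V t u) (at t within {0..})"
    and X_u: "\<And>t u. 0 \<le> t \<Longrightarrow> (X t has_vector_derivative P t u) (at u)"
    and P_u: "\<And>t u. 0 \<le> t \<Longrightarrow> (P t has_vector_derivative S t u) (at u)"
    and V_u: "\<And>t u. 0 \<le> t \<Longrightarrow> (V t has_vector_derivative W t u) (at u)"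
    and cX: "continuous_on ({0..} \<times> UNIV) (\<lambda>p. X (fst p) (snd p))"
    and cV: "continuous_on ({0..} \<times> UNIV) (\<lambda>p. V (fst p) (snd p))"
    and cP: "continuous_on ({0..} \<times> UNIV) (\<lambda>p. P (fst p) (snd p))"
    and cS: "continuous_on ({0..} \<times> UNIV) (\<lambda>p. S (fst p) (snd p))"
    and cW: "continuous_on ({0..} \<times> UNIV) (\<lambda>p. W (fst p) (snd p))"
    and P0: "\<And>t u. 0 \<le> t \<Longrightarrow> P t u \<noteq> 0"
    and per: "\<And>t u. 0 \<le> t \<Longrightarrow> X t (u + 1) = X t u"
    and V: "\<And>t u. 0 \<le> t \<Longrightarrow> V t u = frc j (P t) (S t) u *\<^sub>R (j * sgn (P t u))"
    and j: "j = \<i> \<or> j = - \<i>"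
begin

lemma slice:
  assumes "continuous_on ({0..} \<times> UNIV) (\<lambda>p. F (fst p) (snd p))" "0 \<le> t"
  shows "continuous_on B (F t)"
proof -
  have "continuous_on B ((\<lambda>p. F (fst p) (snd p)) \<circ> (\<lambda>u. (t, u)))"
    by (intro continuous_on_compose continuous_intros continuous_on_subset[OF assms(1)]) (use assms in auto)
  then show ?thesis by (simp add: o_def)
qed

lemma slice_t:
  assumes "continuous_on ({0..} \<times> UNIV) (\<lambda>p. F (fst p) (snd p))" "B \<subseteq> {0..}"
  shows "continuous_on B (\<lambda>t. F t u)"
proof -
  have "continuous_on B ((\<lambda>p. F (fst p) (snd p)) \<circ> (\<lambda>t. (t, u)))"
    by (intro continuous_on_compose continuous_intros continuous_on_subset[OF assms(1)]) (use assms in auto)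
  then show ?thesis by (simp add: o_def)
qed

lemma joint:
  assumes "continuous_on ({0..} \<times> UNIV) (\<lambda>p. F (fst p) (snd p))" "B \<subseteq> {0..} \<times> UNIV"
  shows "continuous_on B (\<lambda>(t, u). F t u)"
  using continuous_on_subset[OF assms] by (simp add: case_prod_unfold)

lemma curve_periodic: assumes t: "0 \<le> t" shows "X t 1 = X t 0" "P t 1 = P t 0"
proof -
  show "X t 1 = X t 0" using per[OF t, of 0] by simp
  have "((\<lambda>u. X t (u + 1)) has_vector_derivative P t (0 + 1)) (at 0)"
    using vector_diff_chain_at[of "\<lambda>u. u + 1" 1 0 "X t" "P t 1"] X_u[OF t, of 1]
      has_vector_derivative_add[OF has_vector_derivative_id has_vector_derivative_const]
    by (fastforce simp: o_def)
  then have "(X t has_vector_derivative P t 1) (at 0)" by (simp add: per[OF t])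
  then show "P t 1 = P t 0" using X_u[OF t, of 0] vector_derivative_unique_at by blast
qed

lemma velocity_periodic: assumes t: "0 \<le> t" shows "V t 1 = V t 0"
proof (rule vector_derivative_unique_within)
  have X': "((\<lambda>s. X s u) has_vector_derivative V t u) (at t within {t..})" for u
    using t by (intro has_vector_derivative_within_subset[OF X_t]) auto
  show "((\<lambda>s. X s 0) has_vector_derivative V t 1) (at t within {t..})"
    by (rule has_vector_derivative_transform[OF _ _ X']) (use t in \<open>auto simp: curve_periodic(1)\<close>)
  show "((\<lambda>s. X s 0) has_vector_derivative V t 0) (at t within {t..})" by (rule X')
  show "at t within {t..} \<noteq> bot" by (simp add: at_within_Ici_at_right)
qed

lemma loop: "0 \<le> t \<Longrightarrow> closed_loop (X t) (P t) (S t) j"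
  by unfold_locales (auto simp: X_u P_u P0 curve_periodic j intro: slice[OF cS])

text \<open>The mixed partial derivatives agree because \<open>P\<close> can be recovered from \<open>V\<close> by
  differentiating the integral of \<open>V\<close> over time under the integral sign.\<close>

lemma P_t: assumes t: "0 \<le> t"
  shows "((\<lambda>s. P s u) has_vector_derivative W t u) (at t within {0..})"
proof -
  have P_eq: "P s u = P 0 u + integral {0..s} (\<lambda>r. W r u)" if s: "0 \<le> s" for s
  proof -
    have X_eq: "X s x = X 0 x + integral {0..s} (\<lambda>r. V r x)" for x
    proof -
      have "((\<lambda>r. V r x) has_integral X s x - X 0 x) {0..s}"
        using s by (intro fundamental_theorem_of_calculus has_vector_derivative_within_subset[OF X_t]) auto
      then show ?thesis by (simp add: integral_unique)
    qed
    have "((\<lambda>x. integral (cbox 0 s) (\<lambda>r. V r x)) has_vector_derivative integral (cbox 0 s) (\<lambda>r. W r u)) (at u within UNIV)"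
    proof (rule leibniz_rule_vector_derivative)
      show "continuous_on (UNIV \<times> cbox 0 s) (\<lambda>(x, t). W t x)"
      proof -
        have "continuous_on (UNIV \<times> cbox 0 s) ((\<lambda>p. W (fst p) (snd p)) \<circ> (\<lambda>p. (snd p, fst p)))"
          by (intro continuous_on_compose continuous_intros continuous_on_subset[OF cW]) auto
        then show ?thesis by (simp add: o_def case_prod_unfold)
      qed
    qed (auto intro!: V_u integrable_continuous_real slice_t[OF cV])
    then have "((\<lambda>x. X 0 x + integral {0..s} (\<lambda>r. V r x)) has_vector_derivative
        P 0 u + integral {0..s} (\<lambda>r. W r u)) (at u)"
      by (intro has_vector_derivative_add X_u) auto
    then have "(X s has_vector_derivative P 0 u + integral {0..s} (\<lambda>r. W r u)) (at u)"
      by (simp flip: X_eq)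
    then show ?thesis using X_u[OF s] vector_derivative_unique_at by blast
  qed
  \<comment> \<open>The compact interval reaches beyond \<open>t\<close>, so that near
    \<open>t\<close> it agrees with \<open>{0..}\<close>.\<close>
  have "((\<lambda>s. integral {0..s} (\<lambda>r. W r u)) has_vector_derivative W t u) (at t within {0..t+1})"
    using t by (intro integral_has_vector_derivative slice_t[OF cW]) auto
  then have "((\<lambda>s. P 0 u + integral {0..s} (\<lambda>r. W r u)) has_vector_derivative W t u) (at t within {0..t+1})"
    using has_vector_derivative_add[OF has_vector_derivative_const] by fastforce
  then have "((\<lambda>s. P s u) has_vector_derivative W t u) (at t within {0..t+1})"
  proof (rule has_vector_derivative_transform[rotated 2])
    show "t \<in> {0..t+1}" using t by simp
    show "P s u = P 0 u + integral {0..s} (\<lambda>r. W r u)" if "s \<in> {0..t+1}" for s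
      by (rule P_eq) (use that in simp)
  qed
  moreover have "at t within {0..t+1} = at t within {0..}"
    by (rule at_within_nhd[of t "{..<t+1}"]) auto
  ultimately show ?thesis by simp
qed

section \<open>Evolution of length, area and centre\<close>

abbreviation L where "L t \<equiv> len (P t)"
abbreviation A where "A t \<equiv> area j (X t) (P t)"
abbreviation c where "c t \<equiv> ctr (X t) (P t)"
abbreviation k where "k t \<equiv> kap j (P t) (S t)"
abbreviation f where "f t \<equiv> frc j (P t) (S t)"
abbreviation E where "E t \<equiv> ener j (P t) (S t)"
abbreviation K where "K t \<equiv> turn j (P t) (S t)"

text \<open>The velocity is normal, so differentiating the vanishing of its tangential part in space
  expresses the stretching rate of the speed through the curvature.\<close>

lemma stretching_rate: assumes t: "0 \<le> t"
  shows "sgn (P t u) \<bullet> W t u = - (k t u * f t u * norm (P t u))"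
proof -
  interpret l: closed_loop "X t" "P t" "S t" j by (rule loop[OF t])
  have "((\<lambda>u. sgn (P t u) \<bullet> V t u) has_vector_derivative
      sgn (P t u) \<bullet> W t u + ((k t u * norm (P t u)) *\<^sub>R (j * sgn (P t u))) \<bullet> V t u) (at u)"
    using bounded_bilinear.has_vector_derivative[OF bounded_bilinear_inner
        sgn_complex_has_vector_derivative[OF P_u P0 j] V_u, OF t t t, of u]
    by (simp add: kap_def power2_eq_square P0[OF t])
  moreover have "sgn (P t u) \<bullet> V t u = 0" for u
    by (simp add: V[OF t] l.rotation_simps)
  ultimately have "((\<lambda>u. 0) has_vector_derivative
      sgn (P t u) \<bullet> W t u + ((k t u * norm (P t u)) *\<^sub>R (j * sgn (P t u))) \<bullet> V t u) (at u)"
    by simp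
  then have "sgn (P t u) \<bullet> W t u + ((k t u * norm (P t u)) *\<^sub>R (j * sgn (P t u))) \<bullet> V t u = 0"
    using vector_derivative_unique_at has_vector_derivative_const by blast
  moreover have "(j * sgn (P t u)) \<bullet> (j * sgn (P t u)) = 1"
    using l.norm_T[of u] unfolding l.rotation_simps(1) by (simp add: dot_square_norm)
  ultimately show ?thesis unfolding V[OF t] by (simp add: algebra_simps)
qed

lemma norm_P_t: assumes t: "0 \<le> t"
  shows "((\<lambda>s. norm (P s u)) has_real_derivative sgn (P t u) \<bullet> W t u) (at t within {0..})"
proof -
  have "((\<lambda>s. norm (P s u)) has_derivative (\<lambda>x. (x *\<^sub>R W t u) \<bullet> sgn (P t u))) (at t within {0..})"
    using has_derivative_compose[OF P_t[OF t, unfolded has_vector_derivative_def] has_derivative_norm[OF P0[OF t]]]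
    by simp
  then show ?thesis by (simp add: has_field_derivative_def inner_commute mult_commute_abs)
qed

lemma joint_sgn_P: "continuous_on ({0..} \<times> UNIV) (\<lambda>p. sgn (P (fst p) (snd p)))"
  unfolding sgn_div_norm by (intro continuous_intros cP) (auto simp: P0)

lemma L_t: assumes t: "0 \<le> t"
  shows "(L has_real_derivative - (E t + 2 * pi / L t * (K t - 2 * pi))) (at t within {0..})"
proof -
  interpret l: closed_loop "X t" "P t" "S t" j by (rule loop[OF t])
  have "((\<lambda>t. integral (cbox 0 1) (\<lambda>u. norm (P t u))) has_real_derivative
      integral (cbox 0 1) (\<lambda>u. sgn (P t u) \<bullet> W t u)) (at t within {0..})"
    by (rule leibniz_rule_field_derivative)
      (use t in \<open>auto intro!: norm_P_t integrable_continuous_real continuous_intros slice[OF cP]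
        joint joint_sgn_P cW\<close>)
  moreover have "integral {0..1} (\<lambda>u. sgn (P t u) \<bullet> W t u) = - integral {0..1} (\<lambda>u. k t u * f t u * norm (P t u))"
    by (simp add: stretching_rate[OF t])
  ultimately show ?thesis by (simp add: len_def[abs_def] l.dissipation)
qed

lemma A_t: assumes t: "0 \<le> t"
  shows "(A has_real_derivative 2 * pi - K t) (at t within {0..})"
proof -
  interpret l: closed_loop "X t" "P t" "S t" j by (rule loop[OF t])
  note [continuous_intros] = slice[OF cX] slice[OF cP] slice[OF cW] slice[OF cV]
  have "((\<lambda>t. integral (cbox 0 1) (\<lambda>u. (j * X t u) \<bullet> P t u)) has_vector_derivative
      integral (cbox 0 1) (\<lambda>u. (j * X t u) \<bullet> W t u + (j * V t u) \<bullet> P t u)) (at t within {0..})"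
    by (rule leibniz_rule_vector_derivative)
      (use t in \<open>auto intro!: bounded_bilinear.has_vector_derivative[OF bounded_bilinear_inner]
        has_vector_derivative_mult_right X_t P_t integrable_continuous_real continuous_intros
        joint cX cP cV cW\<close>)
  moreover have "integral {0..1} (\<lambda>u. (j * X t u) \<bullet> W t u + (j * V t u) \<bullet> P t u) = 2 * (2 * pi - K t)"
  proof -
    have VP: "(j * V t u) \<bullet> P t u = - (f t u * norm (P t u))" for u
    proof -
      have "(j * V t u) \<bullet> P t u = f t u * ((j * (j * sgn (P t u))) \<bullet> (norm (P t u) *\<^sub>R sgn (P t u)))"
        by (simp only: l.vT V[OF t]) (simp add: algebra_simps)
      also have "j * (j * sgn (P t u)) = - sgn (P t u)"
        using l.rotation_simps(5) by (simp flip: mult.assoc)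
      finally show ?thesis using l.norm_T[of u] by (simp add: dot_square_norm)
    qed
    \<comment> \<open>Integration by parts: the derivative of the inner product of
      \<open>j * X t u\<close> and \<open>V t u\<close> integrates to zero, so the term with
      \<open>W\<close> contributes as much as the term with \<open>j * V t u\<close>.\<close>
    have "((\<lambda>u. (j * X t u) \<bullet> W t u + (j * P t u) \<bullet> V t u) has_integral
        (j * X t 1) \<bullet> V t 1 - (j * X t 0) \<bullet> V t 0) {0..1}"
      using t by (intro fundamental_theorem_of_calculus
          bounded_bilinear.has_vector_derivative[OF bounded_bilinear_inner]
          has_vector_derivative_mult_right has_vector_derivative_at_within[OF X_u]
          has_vector_derivative_at_within[OF V_u]) auto
    then have "((\<lambda>u. (j * X t u) \<bullet> W t u + (j * P t u) \<bullet> V t u) has_integral 0) {0..1}"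
      by (simp add: velocity_periodic[OF t] l.Y01)
    then have "((\<lambda>u. ((j * X t u) \<bullet> W t u + (j * P t u) \<bullet> V t u) + 2 * ((j * V t u) \<bullet> P t u)) has_integral
        0 + 2 * integral {0..1} (\<lambda>u. (j * V t u) \<bullet> P t u)) {0..1}"
      by (intro has_integral_add has_integral_mult_right integrable_integral
        integrable_continuous_real continuous_intros) (use t in auto)
    moreover have "((j * X t u) \<bullet> W t u + (j * P t u) \<bullet> V t u) + 2 * ((j * V t u) \<bullet> P t u)
       = (j * X t u) \<bullet> W t u + (j * V t u) \<bullet> P t u" for u
      using l.rotation_simps(2)[of "V t u" "P t u"] by (simp add: inner_commute)
    ultimately have "integral {0..1} (\<lambda>u. (j * X t u) \<bullet> W t u + (j * V t u) \<bullet> P t u) =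
        2 * integral {0..1} (\<lambda>u. (j * V t u) \<bullet> P t u)"
      by (simp add: integral_unique)
    then show ?thesis by (simp add: VP l.int_f)
  qed
  ultimately have "((\<lambda>t. integral {0..1} (\<lambda>u. (j * X t u) \<bullet> P t u)) has_real_derivative 2 * (2 * pi - K t))
      (at t within {0..})"
    by (simp add: has_real_derivative_iff_has_vector_derivative)
  from DERIV_cdivide[OF this, of 2] show ?thesis
    by (simp only: area_def[abs_def] nonzero_mult_div_cancel_left[OF zero_neq_numeral[symmetric]])
qed

definition ctr_velocity where "ctr_velocity t = (1 / L t) *\<^sub>R integral {0..1} (\<lambda>u.
    (f t u * norm (P t u)) *\<^sub>R (j * sgn (P t u)) - (k t u * f t u * norm (P t u)) *\<^sub>R (X t u - c t))"

text \<open>Quotient rule for \<open>M t / L t\<close>. The change of \<open>L\<close> contributes a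
  multiple of \<open>c t\<close> that turns \<open>X t u\<close> into \<open>X t u - c t\<close>,
  which is bounded by the length.\<close>

lemma c_t: assumes t: "0 \<le> t"
  shows "(c has_vector_derivative ctr_velocity t) (at t within {0..})"
proof -
  interpret l: closed_loop "X t" "P t" "S t" j by (rule loop[OF t])
  note [continuous_intros] = slice[OF cX] slice[OF cP] slice[OF cW] slice[OF cV]
  define M where "M t = integral {0..1} (\<lambda>u. norm (P t u) *\<^sub>R X t u)" for t
  define g where "g u = k t u * f t u * norm (P t u)" for u
  have cg [continuous_intros]: "continuous_on B g" for B
    unfolding g_def by (intro continuous_intros)
  have M_eq: "M t = L t *\<^sub>R c t" by (simp add: M_def l.L_c)
  have "((\<lambda>t. integral (cbox 0 1) (\<lambda>u. norm (P t u) *\<^sub>R X t u)) has_vector_derivative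
      integral (cbox 0 1) (\<lambda>u. norm (P t u) *\<^sub>R V t u + (sgn (P t u) \<bullet> W t u) *\<^sub>R X t u)) (at t within {0..})"
    by (rule leibniz_rule_vector_derivative)
      (use t in \<open>auto intro!: has_vector_derivative_scaleR norm_P_t X_t integrable_continuous_real continuous_intros
        joint cX cP cV cW joint_sgn_P\<close>)
  then have M': "(M has_vector_derivative
      integral {0..1} (\<lambda>u. norm (P t u) *\<^sub>R V t u - g u *\<^sub>R X t u)) (at t within {0..})"
    by (simp add: M_def[abs_def] stretching_rate[OF t] g_def)
  have L': "(L has_real_derivative - integral {0..1} g) (at t within {0..})"
    using L_t[OF t] by (simp add: g_def[abs_def] l.dissipation)
  have "((\<lambda>t. inverse (L t) *\<^sub>R M t) has_vector_derivative
      inverse (L t) *\<^sub>R integral {0..1} (\<lambda>u. norm (P t u) *\<^sub>R V t u - g u *\<^sub>R X t u)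
      + (- (inverse (L t) * - integral {0..1} g * inverse (L t))) *\<^sub>R M t) (at t within {0..})"
    using l.L_pos by (intro has_vector_derivative_scaleR M' DERIV_inverse' L') auto
  moreover have "inverse (L t) *\<^sub>R integral {0..1} (\<lambda>u. norm (P t u) *\<^sub>R V t u - g u *\<^sub>R X t u)
      + (- (inverse (L t) * - integral {0..1} g * inverse (L t))) *\<^sub>R M t = inverse (L t) *\<^sub>R
      (integral {0..1} (\<lambda>u. norm (P t u) *\<^sub>R V t u - g u *\<^sub>R X t u) + integral {0..1} g *\<^sub>R c t)"
    using l.L_pos by (simp add: M_eq scaleR_add_right)
  moreover have "integral {0..1} (\<lambda>u. norm (P t u) *\<^sub>R V t u - g u *\<^sub>R X t u) + integral {0..1} g *\<^sub>R c t
     = integral {0..1} (\<lambda>u. (f t u * norm (P t u)) *\<^sub>R (j * sgn (P t u)) - g u *\<^sub>R (X t u - c t))"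
  proof -
    have "((\<lambda>u. (norm (P t u) *\<^sub>R V t u - g u *\<^sub>R X t u) + g u *\<^sub>R c t) has_integral
       integral {0..1} (\<lambda>u. norm (P t u) *\<^sub>R V t u - g u *\<^sub>R X t u) + integral {0..1} g *\<^sub>R c t) {0..1}"
      by (intro has_integral_add has_integral_scaleR_left integrable_integral
        integrable_continuous_real continuous_intros t)
    then show ?thesis
      by (simp add: V[OF t] integral_unique scaleR_diff_right mult.commute algebra_simps)
  qed
  ultimately have "((\<lambda>t. inverse (L t) *\<^sub>R M t) has_vector_derivative ctr_velocity t) (at t within {0..})"
    by (simp add: ctr_velocity_def g_def inverse_eq_divide)
  then show ?thesis by (simp add: M_def[abs_def] ctr_def[abs_def] inverse_eq_divide)
qed

lemma ctr_velocity_bound: assumes t: "0 \<le> t"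
  shows "L t * norm (ctr_velocity t) \<le> L t * E t + (1 + 2 * pi) * sqrt (L t * E t)"
proof -
  interpret l: closed_loop "X t" "P t" "S t" j by (rule loop[OF t])
  show ?thesis using l.centre_velocity_bound l.L_pos by (simp add: ctr_velocity_def)
qed

section \<open>The turning number is one\<close>

text \<open>\<open>K t / (2 * pi)\<close> is an integer by \<open>turn_integer\<close> and depends
  continuously on time.\<close>

lemma K_const: obtains m :: int where "\<And>t. 0 \<le> t \<Longrightarrow> K t = 2 * pi * m"
proof -
  have "continuous_on ({0..} \<times> UNIV) (\<lambda>p. k (fst p) (snd p) * norm (P (fst p) (snd p)))"
    unfolding kap_def by (intro continuous_intros cS cP joint_sgn_P) (auto simp: P0)
  then have "continuous_on {0..} (\<lambda>t. integral (cbox 0 1) (\<lambda>u. k t u * norm (P t u)))"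
    by (intro integral_continuous_on_param joint) auto
  then have cK: "continuous_on {0..} (\<lambda>t. K t / (2 * pi))"
    by (intro continuous_intros) (auto simp: turn_def[abs_def])
  have "K t / (2 * pi) \<in> \<int>" if "0 \<le> t" for t
    using closed_loop.turn_integer[OF loop[OF that]] by auto
  then have "(\<lambda>t. K t / (2 * pi)) constant_on {0..}"
    by (intro continuous_discrete_range_constant[OF _ cK])
      (auto intro!: exI[of _ 1] simp: Ints_nonzero_abs_ge1 elim!: Ints_cases simp flip: of_int_diff)
  then obtain m where m: "\<And>t. 0 \<le> t \<Longrightarrow> K t / (2 * pi) = m" by (auto simp: constant_on_def)
  moreover obtain n :: int where "K 0 = 2 * pi * n" using closed_loop.turn_integer[OF loop] by blast
  ultimately have "m = n" by (metis nonzero_mult_div_cancel_left order_refl mult_eq_0_iff pi_neq_zero zero_neq_numeral)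
  then have "K t = 2 * pi * n" if "0 \<le> t" for t using m[OF that] by (simp add: field_simps)
  then show ?thesis using that by blast
qed

lemma L_pos: "0 \<le> t \<Longrightarrow> 0 < L t"
  using closed_loop.L_pos[OF loop] .

lemma isoperimetric: "0 \<le> t \<Longrightarrow> 4 * pi * A t \<le> (L t)\<^sup>2"
  using closed_loop.isoperimetric[OF loop, of t] by simp

text \<open>Squaring removes the factor \<open>1 / L t\<close> in front of
  \<open>K t - 2 * pi\<close>, so that the rates of decrease become uniform in time.\<close>

lemma L_sq_t: assumes t: "0 \<le> t"
  shows "((\<lambda>t. (L t)\<^sup>2) has_real_derivative - 2 * (L t * E t + 2 * pi * (K t - 2 * pi))) (at t within {0..})"
  by (rule DERIV_cong[OF DERIV_power[OF L_t[OF t]]]) (use L_pos[OF t] in \<open>simp add: field_simps\<close>)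

text \<open>The square of \<open>K t - 2 * pi\<close> from \<open>ener_ge\<close> and the term
  \<open>2 * pi * (K t - 2 * pi)\<close> share a factor and add up to
  \<open>K t * (K t - 2 * pi)\<close>.\<close>

lemma L_sq_t_le: assumes t: "0 \<le> t"
  shows "- 2 * (L t * E t + 2 * pi * (K t - 2 * pi)) \<le> - 2 * K t * (K t - 2 * pi)"
  using closed_loop.ener_ge[OF loop[OF t]] by (simp add: power2_eq_square algebra_simps)

text \<open>Any turning number other than one contradicts global existence: either the squared length
  decreases at a uniform rate, or the area grows linearly although the length is bounded.\<close>

lemma K_eq: assumes t: "0 \<le> t" shows "K t = 2 * pi"
proof -
  obtain m :: int where K: "\<And>t. 0 \<le> t \<Longrightarrow> K t = 2 * pi * m" using K_const by blast
  have le: "- 2 * (L t * E t + 2 * pi * (K t - 2 * pi)) \<le> - (8 * pi\<^sup>2 * of_int (m * (m - 1)))" if "0 \<le> t" for t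
    using L_sq_t_le[OF that] by (simp add: K[OF that] power2_eq_square algebra_simps)
  consider "m = 1" | "m = 0" | "m < 0 \<or> 1 < m" by linarith
  then show ?thesis
  proof cases
    case 1
    then show ?thesis using K[OF t] by simp
  next
    case 2
    have False
    proof (rule no_nonneg_uniformly_decreasing[where g = "\<lambda>t. (L t)\<^sup>2 - 4 * pi * A t"])
      show "((\<lambda>t. (L t)\<^sup>2 - 4 * pi * A t) has_real_derivative
          - 2 * (L t * E t + 2 * pi * (K t - 2 * pi)) - 4 * pi * (2 * pi - K t)) (at t within {0..})"
        if "0 \<le> t" for t
        by (intro DERIV_diff L_sq_t DERIV_cmult A_t that)
      show "- 2 * (L t * E t + 2 * pi * (K t - 2 * pi)) - 4 * pi * (2 * pi - K t) \<le> - (8 * pi\<^sup>2)"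
        if "0 \<le> t" for t
        using le[OF that] 2 by (simp add: K[OF that] power2_eq_square)
    qed (use isoperimetric in auto)
    then show ?thesis ..
  next
    case 3
    then have "1 \<le> m * (m - 1)"
      using zero_less_mult_iff[of m "m - 1"] by linarith
    then have "(1::real) \<le> of_int (m * (m - 1))" by (simp only: of_int_1_le_iff)
    then have m: "8 * pi\<^sup>2 * 1 \<le> 8 * pi\<^sup>2 * (of_int (m * (m - 1)) :: real)" by (intro mult_left_mono) auto
    have False
    proof (rule no_nonneg_uniformly_decreasing[OF L_sq_t])
      show "- 2 * (L t * E t + 2 * pi * (K t - 2 * pi)) \<le> - (8 * pi\<^sup>2)" if "0 \<le> t" for t
        using le[OF that] m by linarith
    qed auto
    then show ?thesis ..
  qed
qed

section \<open>Conserved area and exponential decay of the deficit\<close>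

lemma A_const: assumes t: "0 \<le> t" shows "A t = A 0"
proof (rule antisym)
  have A': "(A has_real_derivative 0) (at s within {0..})" if "0 \<le> s" for s
    using A_t[OF that] by (simp add: K_eq[OF that])
  show "A t \<le> A 0"
    by (rule nonincreasing_on_atLeast[OF A']) (use t in auto)
  have "((\<lambda>s. - A s) has_real_derivative - 0) (at s within {0..})" if "0 \<le> s" for s
    by (rule DERIV_minus[OF A'[OF that]])
  then have "- A t \<le> - A 0"
    by (rule nonincreasing_on_atLeast) (use t in auto)
  then show "A 0 \<le> A t" by simp
qed

lemma L_sq_t_eq: "0 \<le> t \<Longrightarrow> ((\<lambda>t. (L t)\<^sup>2) has_real_derivative - 2 * (L t * E t)) (at t within {0..})"
  using L_sq_t[of t] by (simp add: K_eq)

lemma E_nonneg: "0 \<le> t \<Longrightarrow> 0 \<le> E t"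
  using closed_loop.ener_nonneg[OF loop] .

lemma L_antimono: assumes "0 \<le> t" shows "L t \<le> L 0"
proof (rule nonincreasing_on_atLeast[where g = L])
  show "(L has_real_derivative - E s) (at s within {0..})" if "0 \<le> s" for s
    using L_t[OF that] by (simp add: K_eq[OF that])
qed (use assms E_nonneg in auto)

text \<open>The conserved area is frozen at time 0, so that only the length varies.\<close>

definition deficit where "deficit t = (L t)\<^sup>2 - 4 * pi * A 0"

lemma deficit_nonneg: "0 \<le> t \<Longrightarrow> 0 \<le> deficit t"
  using isoperimetric[of t] A_const[of t] by (simp add: deficit_def)

lemma deficit_le: "0 \<le> t \<Longrightarrow> 2 * pi\<^sup>2 * deficit t \<le> (L t)\<^sup>2 * (L t * E t)"
  using closed_loop.deficit_le_ener[OF loop[of t] K_eq[of t]] A_const[of t]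
  by (simp add: deficit_def power2_eq_square power3_eq_cube mult.assoc)

lemma deficit_t: "0 \<le> t \<Longrightarrow> (deficit has_real_derivative - 2 * (L t * E t)) (at t within {0..})"
  using DERIV_diff[OF L_sq_t_eq DERIV_const] by (fastforce simp: deficit_def[abs_def])

text \<open>Without enclosed area the isoperimetric deficit is at least the squared length, and the
  squared length would decrease at a uniform rate.\<close>

lemma A_pos: "0 < A 0"
proof (rule ccontr)
  assume "\<not> 0 < A 0"
  then have A: "A 0 \<le> 0" by simp
  show False
  proof (rule no_nonneg_uniformly_decreasing[OF L_sq_t_eq])
    show "- 2 * (L t * E t) \<le> - (4 * pi\<^sup>2)" if t: "0 \<le> t" for t
    proof -
      have "(L t)\<^sup>2 \<le> deficit t" using A by (simp add: deficit_def mult_nonneg_nonpos)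
      then have "2 * pi\<^sup>2 * (L t)\<^sup>2 \<le> 2 * pi\<^sup>2 * deficit t" by (intro mult_left_mono) auto
      then have "(L t)\<^sup>2 * (2 * pi\<^sup>2) \<le> (L t)\<^sup>2 * (L t * E t)"
        unfolding mult.commute[of "(L t)\<^sup>2" "2 * pi\<^sup>2"] using deficit_le[OF t] by linarith
      then have "2 * pi\<^sup>2 \<le> L t * E t" using L_pos[OF t] by simp
      then show ?thesis by simp
    qed
  qed auto
qed

text \<open>The constant comes from \<open>deficit_le\<close> with \<open>L t\<close> replaced by
  the larger \<open>L 0\<close>.\<close>

definition rate where "rate = 2 * pi\<^sup>2 / (L 0)\<^sup>2"
definition weighted_deficit where "weighted_deficit t = exp (rate * t) * deficit t"

lemma rate_pos: "0 < rate" using L_pos[of 0] by (simp add: rate_def)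

lemma weighted_deficit_t: "0 \<le> t \<Longrightarrow> (weighted_deficit has_real_derivative exp (rate * t) * (rate * deficit t - 2 * (L t * E t))) (at t within {0..})"
  unfolding weighted_deficit_def by (auto intro!: derivative_eq_intros deficit_t simp: algebra_simps)

lemma rate_deficit_le: assumes t: "0 \<le> t" shows "rate * deficit t \<le> L t * E t"
proof -
  have "(L t)\<^sup>2 * (L t * E t) \<le> (L 0)\<^sup>2 * (L t * E t)"
    using L_antimono[OF t] L_pos[OF t] E_nonneg[OF t] by (intro mult_right_mono power_mono) auto
  then have "2 * pi\<^sup>2 * deficit t \<le> (L 0)\<^sup>2 * (L t * E t)" using deficit_le[OF t] by linarith
  then show ?thesis using L_pos[of 0] by (simp add: rate_def field_simps)
qed

text \<open>Half of the dissipation \<open>2 * (L t * E t)\<close> pays for the growth of the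
  weight; the other half survives to control the drift of the centre.\<close>

lemma weighted_deficit_t_le: assumes t: "0 \<le> t"
  shows "exp (rate * t) * (rate * deficit t - 2 * (L t * E t)) \<le> - (exp (rate * t) * (L t * E t))"
proof -
  have "exp (rate * t) * (rate * deficit t - 2 * (L t * E t)) \<le> exp (rate * t) * (- (L t * E t))"
    using rate_deficit_le[OF t] by (intro mult_left_mono) auto
  then show ?thesis by simp
qed

lemma deficit_tendsto: "(deficit \<longlongrightarrow> 0) at_top"
proof (rule tendsto_sandwich)
  show "\<forall>\<^sub>F t in at_top. 0 \<le> deficit t"
    using eventually_ge_at_top[of 0] by eventually_elim (rule deficit_nonneg)
  show "\<forall>\<^sub>F t in at_top. deficit t \<le> deficit 0 * exp (- (rate * t))"
    using eventually_ge_at_top[of 0]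
  proof eventually_elim
    case (elim t)
    have "weighted_deficit t \<le> weighted_deficit 0"
    proof (rule nonincreasing_on_atLeast[OF weighted_deficit_t])
      show "exp (rate * s) * (rate * deficit s - 2 * (L s * E s)) \<le> 0" if "0 \<le> s" for s
      proof -
        have "0 \<le> exp (rate * s) * (L s * E s)" using L_pos[OF that] E_nonneg[OF that] by simp
        then show ?thesis using weighted_deficit_t_le[OF that] by linarith
      qed
    qed (use elim in auto)
    then show ?case by (simp add: weighted_deficit_def exp_minus field_simps)
  qed
  show "((\<lambda>t. deficit 0 * exp (- (rate * t))) \<longlongrightarrow> 0) at_top"
    by (intro tendsto_mult_right_zero filterlim_compose[OF exp_at_bot] filterlim_uminus_at_bot[THEN iffD2])
      (simp add: filterlim_tendsto_pos_mult_at_top[OF tendsto_const rate_pos filterlim_ident])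
qed auto

lemma L_ge: "0 \<le> t \<Longrightarrow> sqrt (4 * pi * A 0) \<le> L t"
  using isoperimetric[of t] A_const[of t] L_pos[of t] by (intro real_le_lsqrt) auto

text \<open>By the arithmetic-geometric mean inequality the drift of the centre is dominated by the
  derivative of the bounded function \<open>- C (weighted_deficit t + exp (- rate * t) / rate)\<close>.\<close>

lemma c_converges: obtains l where "(c \<longlongrightarrow> l) at_top"
proof -
  \<comment> \<open>\<open>M\<close> bounds the length from below by \<open>L_ge\<close>, and
    \<open>2 + 2 * pi\<close> collects the coefficients of both terms in
    \<open>ctr_velocity_bound\<close>.\<close>
  define M where "M = sqrt (4 * pi * A 0)"
  have M: "0 < M" using A_pos by (simp add: M_def)
  define C where "C = (2 + 2 * pi) / M"
  have C: "0 \<le> C" using M by (simp add: C_def)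
  define p where "p t = - C * (weighted_deficit t + exp (- (rate * t)) / rate)" for t
  define p' where "p' t = - C * (exp (rate * t) * (rate * deficit t - 2 * (L t * E t)) - exp (- (rate * t)))" for t
  have p: "(p has_real_derivative p' t) (at t within {0..})" if "0 \<le> t" for t
    unfolding p_def p'_def using rate_pos that
    by (auto intro!: derivative_eq_intros weighted_deficit_t simp: field_simps)
  have ctr_velocity_le: "norm (ctr_velocity t) \<le> p' t" if t: "0 \<le> t" for t
  proof -
    define x where "x = L t * E t"
    define e where "e = exp (rate * t)"
    have x: "0 \<le> x" using L_pos[OF t] E_nonneg[OF t] by (simp add: x_def)
    have e: "1 \<le> e" using rate_pos t by (simp add: e_def)
    have ie: "exp (- (rate * t)) = inverse e" by (simp add: e_def exp_minus)
    \<comment> \<open>Both factors are integrable in time: \<open>e * x\<close> through the weighted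
      deficit, and \<open>inverse e\<close> because it decays exponentially.\<close>
    have "sqrt x = sqrt ((e * x) * inverse e)" using e by simp
    also have "\<dots> \<le> (e * x + inverse e) / 2"
      using arith_geo_mean_sqrt[of "e * x" "inverse e"] x e by simp
    also have "\<dots> \<le> e * x + inverse e" using x e by simp
    finally have s: "sqrt x \<le> e * x + inverse e" .
    have "1 * x \<le> e * x" using x e by (intro mult_right_mono)
    moreover have "0 \<le> inverse e" using e by simp
    ultimately have x_le: "x \<le> e * x + inverse e" by linarith
    have "M * norm (ctr_velocity t) \<le> L t * norm (ctr_velocity t)"
      using L_ge[OF t] by (intro mult_right_mono) (auto simp: M_def)
    also have "\<dots> \<le> x + (1 + 2 * pi) * sqrt x" using ctr_velocity_bound[OF t] by (simp add: x_def)
    also have "\<dots> \<le> (e * x + inverse e) + (1 + 2 * pi) * (e * x + inverse e)"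
      using s x_le by (intro add_mono mult_left_mono) auto
    also have "\<dots> = (2 + 2 * pi) * (e * x + inverse e)" by (simp add: algebra_simps)
    finally have "norm (ctr_velocity t) \<le> C * (e * x + inverse e)"
      using M by (simp add: C_def field_simps)
    also have "\<dots> \<le> C * (- (e * (rate * deficit t - 2 * x)) + inverse e)"
      using weighted_deficit_t_le[OF t] C by (intro mult_left_mono add_mono) (auto simp: e_def x_def)
    also have "\<dots> = p' t" unfolding p'_def ie by (simp add: e_def x_def algebra_simps)
    finally show ?thesis .
  qed
  have cont_p: "continuous_on {0..} p" by (rule DERIV_continuous_on[OF p]) auto
  have cont_c: "continuous_on {0..} c"
    unfolding continuous_on_eq_continuous_within
    using c_t has_vector_derivative_continuous by blast
  have inc: "norm (c t - c s) \<le> p t - p s" if st: "0 \<le> s" "s \<le> t" for s t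
  proof (cases "s = t")
    case False
    then have "s < t" using st by simp
    then show ?thesis
    proof (rule differentiable_bound_general)
      fix x assume x: "s < x" "x < t"
      then have "x \<in> interior {0..}" using st by (simp add: interior_real_atLeast)
      then have "at x within {0..} = at x" by (rule at_within_interior)
      moreover have x0: "0 \<le> x" using x st by simp
      ultimately show "(c has_vector_derivative ctr_velocity x) (at x)" "(p has_vector_derivative p' x) (at x)"
        using c_t[OF x0] p[OF x0] by (simp_all add: has_real_derivative_iff_has_vector_derivative)
      show "norm (ctr_velocity x) \<le> p' x" by (rule ctr_velocity_le[OF x0])
    qed (use st in \<open>auto intro: continuous_on_subset[OF cont_p] continuous_on_subset[OF cont_c]\<close>)
  qed simp
  have p_le: "p t \<le> 0" if "0 \<le> t" for t
    using C rate_pos deficit_nonneg[OF that] by (simp add: p_def weighted_deficit_def mult_nonneg_nonneg)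
  show ?thesis
    by (rule convergent_of_increment_bound[where x = c and p = p and B = 0])
      (rule inc p_le that; assumption)+
qed

theorem converges_to_some_circle: "\<exists>z r. 0 < r \<and> converges_to_circle X z r"
proof -
  obtain z where c: "(c \<longlongrightarrow> z) at_top" by (rule c_converges)
  \<comment> \<open>The radius of the disc with the conserved area.\<close>
  define r where "r = sqrt (A 0 / pi)"
  have r: "0 < r" using A_pos by (simp add: r_def)
  define d where "d t = 3 * sqrt (2 * deficit t)" for t
  \<comment> \<open>Total error: distance to the circle about the moving centre, error of its
    radius, error of its centre.\<close>
  define \<eta> where "\<eta> t = d t + \<bar>L t / (2 * pi) - r\<bar> + norm (c t - z)" for t
  have L: "((\<lambda>t. L t / (2 * pi)) \<longlongrightarrow> r) at_top"
  proof -
    have "((\<lambda>t. sqrt (deficit t + 4 * pi * A 0) / (2 * pi)) \<longlongrightarrow> sqrt (0 + 4 * pi * A 0) / (2 * pi)) at_top"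
      by (intro tendsto_intros deficit_tendsto) auto
    moreover have "sqrt (0 + 4 * pi * A 0) / (2 * pi) = r"
      using A_pos by (simp add: r_def real_sqrt_mult real_sqrt_divide real_div_sqrt field_simps)
    moreover have "\<forall>\<^sub>F t in at_top. sqrt (deficit t + 4 * pi * A 0) / (2 * pi) = L t / (2 * pi)"
      using eventually_ge_at_top[of 0]
      by eventually_elim (use L_pos in \<open>auto simp: deficit_def less_imp_le\<close>)
    ultimately show ?thesis by (auto intro: Lim_transform_eventually)
  qed
  have "(d \<longlongrightarrow> 3 * sqrt (2 * 0)) at_top"
    unfolding d_def by (intro tendsto_intros deficit_tendsto)
  then have "(\<eta> \<longlongrightarrow> 0 + \<bar>r - r\<bar> + norm (z - z)) at_top"
    unfolding \<eta>_def by (intro tendsto_intros L c) auto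
  then have \<eta>: "(\<eta> \<longlongrightarrow> 0) at_top" by simp
  have dist1: "\<bar>norm (X t u - z) - r\<bar> \<le> \<eta> t" if t: "0 \<le> t" for t u
  proof -
    interpret l: closed_loop "X t" "P t" "S t" j by (rule loop[OF t])
    \<comment> \<open>The estimates for a loop cover one period, so \<open>u\<close> is moved to
      \<open>frac u\<close>.\<close>
    have "X t (u - of_int n) = X t u" for n :: int
    proof (induction n rule: int_induct[of _ 0])
      case (step1 i) then show ?case using per[OF t, of "u - of_int (i + 1)"] by simp
    next
      case (step2 i) then show ?case using per[OF t, of "u - of_int i"] by (simp add: algebra_simps)
    qed simp
    then have fr: "X t (frac u) = X t u" by (simp add: frac_def)
    have "frac u \<in> {0..1}" by (simp add: frac_lt_1 less_imp_le)
    from l.Hausdorff_near_circle(1)[OF refl this]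
    have "\<bar>norm (X t u - c t) - L t / (2 * pi)\<bar> \<le> d t"
      by (simp add: fr d_def deficit_def A_const[OF t])
    moreover have "\<bar>norm (X t u - z) - norm (X t u - c t)\<bar> \<le> norm (c t - z)"
      using norm_triangle_ineq3[of "X t u - z" "X t u - c t"] by simp
    ultimately show ?thesis unfolding \<eta>_def by linarith
  qed
  have dist2: "\<exists>u. norm (X t u - q) \<le> \<eta> t" if t: "0 \<le> t" and q: "norm (q - z) = r" for t q
  proof -
    interpret l: closed_loop "X t" "P t" "S t" j by (rule loop[OF t])
    define w where "w = (1 / r) *\<^sub>R (q - z)"
    have w: "norm w = 1" using q r by (simp add: w_def)
    obtain u where "norm (X t u - c t - (L t / (2 * pi)) *\<^sub>R w) \<le> d t"
      using l.Hausdorff_near_circle(2)[OF refl w] by (auto simp: d_def deficit_def A_const[OF t])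
    moreover have "norm ((L t / (2 * pi) - r) *\<^sub>R w) = \<bar>L t / (2 * pi) - r\<bar>" using w by simp
    moreover have rw: "q = z + r *\<^sub>R w" using r by (simp add: w_def)
    have "X t u - q = (X t u - c t - (L t / (2 * pi)) *\<^sub>R w) + ((L t / (2 * pi) - r) *\<^sub>R w) + (c t - z)"
      unfolding scaleR_diff_left rw by simp
    ultimately have "norm (X t u - q) \<le> \<eta> t"
      unfolding \<eta>_def by (metis add_mono norm_triangle_mono order_refl)
    then show ?thesis ..
  qed
  have "converges_to_circle X z r"
    unfolding converges_to_circle_def
  proof (intro allI impI)
    fix e :: real assume "0 < e"
    then have "\<forall>\<^sub>F t in at_top. \<eta> t < e" using order_tendstoD(2)[OF \<eta>] by simp
    then show "\<forall>\<^sub>F t in at_top. (\<forall>u. \<bar>norm (X t u - z) - r\<bar> < e) \<and>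
        (\<forall>q. norm (q - z) = r \<longrightarrow> (\<exists>u. norm (X t u - q) < e))"
      using eventually_ge_at_top[of 0]
    proof eventually_elim
      case (elim t)
      then show ?case using dist1 dist2 by (blast intro: le_less_trans)
    qed
  qed
  then show ?thesis using r by blast
qed

end

section \<open>From the definition of the flow to \<open>gage_solution\<close>\<close>

lemma smooth_flowE:
  assumes "smooth_flow F"
  obtains G H where "continuous_on ({0..} \<times> UNIV) (\<lambda>p. F (fst p) (snd p))"
    "\<And>t u. 0 \<le> t \<Longrightarrow> ((\<lambda>s. F s u) has_vector_derivative G t u) (at t within {0..})"
    "\<And>t u. 0 \<le> t \<Longrightarrow> (F t has_vector_derivative H t u) (at u)"
    "smooth_flow G" "smooth_flow H"
  using assms
proof (cases rule: smooth_flow.cases)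
  case (1 G H)
  then show ?thesis by (intro that[of G H]) (auto simp: case_prod_unfold)
qed

theorem theorem4p1:
  fixes X0 :: "real \<Rightarrow> complex" and X :: "real \<Rightarrow> real \<Rightarrow> complex"
  assumes "smooth_curve X0"
    and "embedded_closed_curve X0"
    and "gage_flow_global X0 X"
  shows "\<exists>c r. 0 < r \<and> converges_to_circle X c r"
proof -
  define \<sigma> where "\<sigma> = orientation_sign X0"
  define j where "j = complex_of_real \<sigma> * \<i>"
  have "\<sigma> = 1 \<or> \<sigma> = - 1" by (simp add: \<sigma>_def orientation_sign_def)
  then have j: "j = \<i> \<or> j = - \<i>" by (auto simp: j_def)
  have smooth: "smooth_flow X" and closed: "\<And>t. 0 \<le> t \<Longrightarrow> closed_curve (X t)"
    and regular: "\<And>t. 0 \<le> t \<Longrightarrow> regular_curve (X t)"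
    and flow: "\<And>t u. 0 \<le> t \<Longrightarrow> ((\<lambda>s. X s u) has_vector_derivative
         ((curvature \<sigma> (X t) u - 2 * pi / curve_length (X t)) *\<^sub>R unit_normal \<sigma> (X t) u)) (at t within {0..})"
    using assms(3) by (auto simp: gage_flow_global_def \<sigma>_def)
  obtain V P where X: "continuous_on ({0..} \<times> UNIV) (\<lambda>p. X (fst p) (snd p))"
    "\<And>t u. 0 \<le> t \<Longrightarrow> ((\<lambda>s. X s u) has_vector_derivative V t u) (at t within {0..})"
    "\<And>t u. 0 \<le> t \<Longrightarrow> (X t has_vector_derivative P t u) (at u)"
    and sV: "smooth_flow V" and sP: "smooth_flow P"
    using smooth by (rule smooth_flowE) (rule that; assumption)
  obtain W where V: "continuous_on ({0..} \<times> UNIV) (\<lambda>p. V (fst p) (snd p))"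
    "\<And>t u. 0 \<le> t \<Longrightarrow> (V t has_vector_derivative W t u) (at u)" and sW: "smooth_flow W"
    using sV by (rule smooth_flowE) (rule that; assumption)
  obtain S where P: "continuous_on ({0..} \<times> UNIV) (\<lambda>p. P (fst p) (snd p))"
    "\<And>t u. 0 \<le> t \<Longrightarrow> (P t has_vector_derivative S t u) (at u)" and sS: "smooth_flow S"
    using sP by (rule smooth_flowE) (rule that; assumption)
  have W: "continuous_on ({0..} \<times> UNIV) (\<lambda>p. W (fst p) (snd p))" using sW by (rule smooth_flowE)
  have S: "continuous_on ({0..} \<times> UNIV) (\<lambda>p. S (fst p) (snd p))" using sS by (rule smooth_flowE)
  have vd: "vector_derivative (X t) (at u) = P t u" if "0 \<le> t" for t u
    using X(3)[OF that] by (rule vector_derivative_at)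
  have P0: "P t u \<noteq> 0" if "0 \<le> t" for t u
    using regular[OF that] vd[OF that] by (metis regular_curve_def)
  have V_eq: "V t u = frc j (P t) (S t) u *\<^sub>R (j * sgn (P t u))" if t: "0 \<le> t" for t u
  proof -
    have ut: "unit_tangent (X t) = (\<lambda>u. sgn (P t u))"
      by (simp add: unit_tangent_def fun_eq_iff vd[OF t] sgn_div_norm inverse_eq_divide)
    have n: "unit_normal \<sigma> (X t) u = j * sgn (P t u)"
      by (simp add: unit_normal_def ut j_def)
    have "norm (j * sgn (P t u)) = 1"
      using j P0[OF t, of u] by (auto simp: norm_mult norm_sgn)
    then have nn: "(j * sgn (P t u)) \<bullet> (j * sgn (P t u)) = 1" by (simp add: dot_square_norm)
    have "vector_derivative (unit_tangent (X t)) (at u)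
        = ((S t u \<bullet> (j * sgn (P t u))) / norm (P t u)) *\<^sub>R (j * sgn (P t u))"
      unfolding ut by (intro vector_derivative_at sgn_complex_has_vector_derivative P t P0 j)
    then have "curvature \<sigma> (X t) u = kap j (P t) (S t) u"
      unfolding curvature_def curvature_vector_def n
      by (simp add: vd[OF t] nn kap_def power2_eq_square)
    moreover have "curve_length (X t) = len (P t)"
      by (simp add: curve_length_def len_def vd[OF t])
    ultimately have "((\<lambda>s. X s u) has_vector_derivative frc j (P t) (S t) u *\<^sub>R (j * sgn (P t u)))
        (at t within {0..})"
      using flow[OF t, of u] by (simp add: n frc_def)
    \<comment> \<open>\<open>V\<close> comes from smoothness, while the flow equation provides
      another formula for the same derivative. At \<open>t = 0\<close> it is one-sided, so
      uniqueness has to be justified there as well.\<close>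
    moreover have "at t within {0..} \<noteq> bot"
    proof -
      have "at t within {t..} \<le> at t within {0..}" using t by (intro at_le) auto
      then show ?thesis by (metis at_within_Ici_at_right bot.extremum_uniqueI trivial_limit_at_right_real)
    qed
    ultimately show ?thesis using vector_derivative_unique_within X(2)[OF t] by blast
  qed
  interpret gage_solution X V P S W j
    by unfold_locales (use X V P S W P0 V_eq j closed in \<open>auto simp: closed_curve_def\<close>)
  show ?thesis by (rule converges_to_some_circle)
qed

end
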